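(* Let $0<q<1$, $0<\mu<1$ and $\beta>-1$. Consider the $q$-fractional Sturm--Liouville problem $$D_{q,1^-}^{\mu}\Big((q\,\cdot;q)_{\beta+\mu}\,{}^cD_{q,0^+}^{\mu}y\Big)(x)=\lambda\,x^{-\mu}(qx;q)_{\beta}\,y(x),\qquad x\in A_q^*=\{q^k:k\in\mathbb{N}_0\}\cup\{0\},$$ with boundary conditions $$y(0)=\left[I_{q,1^-}^{1-\mu}\Big((q^{\beta+1}\,\cdot;q)_{\mu}\,{}^cD_{q,0^+}^{\mu}y\Big)\right]\left(\tfrac1q\right)=0 .$$ The functions $$\phi_n(x)=x^{\mu}p_n(x;q^{\mu},q^{\beta}|q),\qquad n\in\mathbb{N}_0,$$ are eigenfunctions of this problem associated to the eigenvalues $$\lambda_n=q^{-n\mu}\frac{\Gamma_q(\mu+\beta+n+1)\,\Gamma_q(\mu+n+1)}{\Gamma_q(\beta+1+n)\,\Gamma_q(n+1)\,\Gamma_q(\mu+1)},\qquad n\in\mathbb{N}_0.$$ Moreover, the eigenfunctions are unique up to a constant multiplier.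
   Context: Notation: $\mathbb{N}_0=\{0,1,2,\dots\}$; $(z;q)_\infty=\prod_{k\ge 0}(1-zq^k)$; for real $\nu$, $(z;q)_\nu=(z;q)_\infty/(zq^{\nu};q)_\infty$; $\Gamma_q(\nu)=\frac{(q;q)_\infty}{(q^\nu;q)_\infty}(1-q)^{1-\nu}$; Jackson integral $\int_0^x f(t)\,d_qt=(1-q)\sum_{n\ge 0}xq^nf(xq^n)$, $\int_c^d=\int_0^d-\int_0^c$; $D_qf(x)=\frac{f(x)-f(qx)}{(1-q)x}$, $D_{q^{-1}}f(x)=\frac{f(x)-f(x/q)}{(1-q^{-1})x}$ for $x\neq0$; $$I_{q,0^+}^{\nu}f(x)=\frac{x^{\nu-1}}{\Gamma_q(\nu)}\int_0^x(qt/x;q)_{\nu-1}f(t)\,d_qt,\qquad I_{q,1^-}^{\nu}f(x)=\frac{1}{\Gamma_q(\nu)}\int_{qx}^{1}t^{\nu-1}(qx/t;q)_{\nu-1}f(t)\,d_qt$$ (the latter formula also used at $x=1/q$). For $0<\mu<1$, the left-sided Caputo and right-sided Riemann--Liouville fractional $q$-derivatives are ${}^cD_{q,0^+}^{\mu}f=I_{q,0^+}^{1-\mu}D_qf$ and $D_{q,1^-}^{\mu}f=-\tfrac1qD_{q^{-1}}I_{q,1^-}^{1-\mu}f$. The little $q$-Jacobi polynomial is, for $\alpha>-1$, $\beta>-1$, $$p_n(x;q^{\alpha},q^{\beta}|q)={}_2\phi_1\left(q^{-n},q^{\alpha+\beta+n+1};q^{\alpha+1};q,qx\right)=\sum_{k=0}^n\frac{(q^{-n};q)_k(q^{\alpha+\beta+n+1};q)_k}{(q^{\alpha+1};q)_k(q;q)_k}(qx)^k.$$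 A complex number $\lambda$ for which the boundary value problem has a non-trivial solution is called an eigenvalue, and the corresponding non-trivial solution an eigenfunction.
   Formalization: The divisor Γ_q(μ+1) in λ_n is removed: at n=0, x=1 the equation forces λ_0=Γ_q(μ+1)Γ_q(μ+β+1)/Γ_q(β+1), and Γ_q(μ+1)<1. At x=0, where x^{-μ} and D_{q^{-1}} are undefined, the equation is read as a limit along q^k. *)

theory Defs
  imports "HOL-Analysis.Analysis"
begin

section \<open>q-shifted factorials and the q-Gamma function\<close>

definition qpoch_inf :: "real \<Rightarrow> real \<Rightarrow> real" where
  "qpoch_inf z q = (\<Prod>k. 1 - z * q ^ k)"

definition qpoch :: "real \<Rightarrow> real \<Rightarrow> real \<Rightarrow> real" where
  "qpoch z q \<nu> = qpoch_inf z q / qpoch_inf (z * q powr \<nu>) q"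

text \<open>For a natural index the factorial is the finite product: the quotient above would be
  \<open>0 / 0\<close> at \<open>z = q\<^sup>-\<^sup>n\<close>.\<close>

definition qpoch_nat :: "real \<Rightarrow> real \<Rightarrow> nat \<Rightarrow> real" where
  "qpoch_nat z q k = (\<Prod>j<k. 1 - z * q ^ j)"

definition q_Gamma :: "real \<Rightarrow> real \<Rightarrow> real" where
  "q_Gamma q \<nu> = qpoch_inf q q / qpoch_inf (q powr \<nu>) q * (1 - q) powr (1 - \<nu>)"


section \<open>Jackson integral and q-derivatives\<close>

text \<open>Eigenvalues are complex, so unknown functions are complex-valued. All functions are total on
  the reals; for arguments in the lattice below, the operators only use their values there.\<close>

definition q_lattice :: "real \<Rightarrow> real set" where
  "q_lattice q = range (\<lambda>k. q ^ k) \<union> {0}"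

definition jackson_summable :: "real \<Rightarrow> (real \<Rightarrow> complex) \<Rightarrow> real \<Rightarrow> bool" where
  "jackson_summable q f x \<longleftrightarrow> summable (\<lambda>n. (x * q ^ n) *\<^sub>R f (x * q ^ n))"

definition jackson :: "real \<Rightarrow> (real \<Rightarrow> complex) \<Rightarrow> real \<Rightarrow> complex" where
  "jackson q f x = (1 - q) *\<^sub>R (\<Sum>n. (x * q ^ n) *\<^sub>R f (x * q ^ n))"

definition q_deriv :: "real \<Rightarrow> (real \<Rightarrow> complex) \<Rightarrow> real \<Rightarrow> complex" where
  "q_deriv q f x = (f x - f (q * x)) /\<^sub>R ((1 - q) * x)"

definition q_inv_deriv :: "real \<Rightarrow> (real \<Rightarrow> complex) \<Rightarrow> real \<Rightarrow> complex" where
  "q_inv_deriv q f x = (f x - f (x / q)) /\<^sub>R ((1 - 1 / q) * x)"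

text \<open>The difference quotients above are meaningless at \<open>0\<close>. As usual in q-calculus, the
  q-derivative and the \<open>q\<^sup>-\<^sup>1\<close>-derivative at \<open>0\<close> are both the limit of
  \<open>(f (q\<^sup>k) - f 0) / q\<^sup>k\<close>.\<close>

definition has_q_deriv_at_0 :: "real \<Rightarrow> (real \<Rightarrow> complex) \<Rightarrow> complex \<Rightarrow> bool" where
  "has_q_deriv_at_0 q f d \<longleftrightarrow> (\<lambda>k. (f (q ^ k) - f 0) /\<^sub>R q ^ k) \<longlonglongrightarrow> d"


section \<open>Fractional q-integrals and q-derivatives\<close>

definition left_integrand :: "real \<Rightarrow> real \<Rightarrow> (real \<Rightarrow> complex) \<Rightarrow> real \<Rightarrow> real \<Rightarrow> complex" where
  "left_integrand q \<nu> f x t = qpoch (q * t / x) q (\<nu> - 1) *\<^sub>R f t"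

definition left_int :: "real \<Rightarrow> real \<Rightarrow> (real \<Rightarrow> complex) \<Rightarrow> real \<Rightarrow> complex" where
  "left_int q \<nu> f x = (x powr (\<nu> - 1) / q_Gamma q \<nu>) *\<^sub>R jackson q (left_integrand q \<nu> f x) x"

definition left_int_exists :: "real \<Rightarrow> real \<Rightarrow> (real \<Rightarrow> complex) \<Rightarrow> real \<Rightarrow> bool" where
  "left_int_exists q \<nu> f x \<longleftrightarrow> jackson_summable q (left_integrand q \<nu> f x) x"

definition right_integrand :: "real \<Rightarrow> real \<Rightarrow> (real \<Rightarrow> complex) \<Rightarrow> real \<Rightarrow> real \<Rightarrow> complex" where
  "right_integrand q \<nu> f x t = (t powr (\<nu> - 1) * qpoch (q * x / t) q (\<nu> - 1)) *\<^sub>R f t"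

definition right_int :: "real \<Rightarrow> real \<Rightarrow> (real \<Rightarrow> complex) \<Rightarrow> real \<Rightarrow> complex" where
  "right_int q \<nu> f x = (1 / q_Gamma q \<nu>) *\<^sub>R
     (jackson q (right_integrand q \<nu> f x) 1 - jackson q (right_integrand q \<nu> f x) (q * x))"

definition right_int_exists :: "real \<Rightarrow> real \<Rightarrow> (real \<Rightarrow> complex) \<Rightarrow> real \<Rightarrow> bool" where
  "right_int_exists q \<nu> f x \<longleftrightarrow> jackson_summable q (right_integrand q \<nu> f x) 1 \<and>
     jackson_summable q (right_integrand q \<nu> f x) (q * x)"

definition caputo :: "real \<Rightarrow> real \<Rightarrow> (real \<Rightarrow> complex) \<Rightarrow> real \<Rightarrow> complex" where
  "caputo q \<mu> f = left_int q (1 - \<mu>) (q_deriv q f)"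

text \<open>\<open>right_RL\<close> is the right-sided Riemann--Liouville derivative at \<open>x \<noteq> 0\<close>;
  \<open>has_right_RL_at_0\<close> is its value at \<open>0\<close>.\<close>

definition right_RL :: "real \<Rightarrow> real \<Rightarrow> (real \<Rightarrow> complex) \<Rightarrow> real \<Rightarrow> complex" where
  "right_RL q \<mu> f x = - (1 / q) *\<^sub>R q_inv_deriv q (right_int q (1 - \<mu>) f) x"

definition has_right_RL_at_0 :: "real \<Rightarrow> real \<Rightarrow> (real \<Rightarrow> complex) \<Rightarrow> complex \<Rightarrow> bool" where
  "has_right_RL_at_0 q \<mu> f v \<longleftrightarrow>
     (\<exists>d. has_q_deriv_at_0 q (right_int q (1 - \<mu>) f) d \<and> v = - (1 / q) *\<^sub>R d)"


section \<open>The Sturm--Liouville problem\<close>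

definition sl_flux :: "real \<Rightarrow> real \<Rightarrow> real \<Rightarrow> (real \<Rightarrow> complex) \<Rightarrow> real \<Rightarrow> complex" where
  "sl_flux q \<mu> \<beta> y x = qpoch (q * x) q (\<beta> + \<mu>) *\<^sub>R caputo q \<mu> y x"

definition sl_bdry :: "real \<Rightarrow> real \<Rightarrow> real \<Rightarrow> (real \<Rightarrow> complex) \<Rightarrow> real \<Rightarrow> complex" where
  "sl_bdry q \<mu> \<beta> y x = qpoch (q powr (\<beta> + 1) * x) q \<mu> *\<^sub>R caputo q \<mu> y x"

definition sl_rhs :: "real \<Rightarrow> real \<Rightarrow> real \<Rightarrow> (real \<Rightarrow> complex) \<Rightarrow> real \<Rightarrow> complex" where
  "sl_rhs q \<mu> \<beta> y x = (x powr (- \<mu>) * qpoch (q * x) q \<beta>) *\<^sub>R y x"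

text \<open>A solution must make every series converge: \<open>suminf\<close> is arbitrary on divergent ones.
  The equation is imposed on the whole lattice. At \<open>x = 0\<close> the factor \<open>x powr (- \<mu>)\<close> is singular
  (and \<open>0\<close> by convention in HOL), so there \<open>x\<^sup>-\<^sup>\<mu> y(x)\<close> is its limit along the
  lattice, and the left-hand side is the derivative at \<open>0\<close>.\<close>

definition sl_well_defined :: "real \<Rightarrow> real \<Rightarrow> real \<Rightarrow> (real \<Rightarrow> complex) \<Rightarrow> bool" where
  "sl_well_defined q \<mu> \<beta> y \<longleftrightarrow>
     (\<forall>k. left_int_exists q (1 - \<mu>) (q_deriv q y) (q ^ k)) \<and>
     (\<forall>x \<in> q_lattice q \<union> {1 / q}. right_int_exists q (1 - \<mu>) (sl_flux q \<mu> \<beta> y) x) \<and>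
     right_int_exists q (1 - \<mu>) (sl_bdry q \<mu> \<beta> y) (1 / q)"

definition sl_equation :: "real \<Rightarrow> real \<Rightarrow> real \<Rightarrow> complex \<Rightarrow> (real \<Rightarrow> complex) \<Rightarrow> bool" where
  "sl_equation q \<mu> \<beta> \<Lambda> y \<longleftrightarrow>
     (\<forall>k. right_RL q \<mu> (sl_flux q \<mu> \<beta> y) (q ^ k) = \<Lambda> * sl_rhs q \<mu> \<beta> y (q ^ k)) \<and>
     (\<exists>r. (\<lambda>k. sl_rhs q \<mu> \<beta> y (q ^ k)) \<longlonglongrightarrow> r \<and>
          has_right_RL_at_0 q \<mu> (sl_flux q \<mu> \<beta> y) (\<Lambda> * r))"

definition sl_solution :: "real \<Rightarrow> real \<Rightarrow> real \<Rightarrow> complex \<Rightarrow> (real \<Rightarrow> complex) \<Rightarrow> bool" where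
  "sl_solution q \<mu> \<beta> \<Lambda> y \<longleftrightarrow>
     sl_well_defined q \<mu> \<beta> y \<and> sl_equation q \<mu> \<beta> \<Lambda> y \<and>
     y 0 = 0 \<and> right_int q (1 - \<mu>) (sl_bdry q \<mu> \<beta> y) (1 / q) = 0"

definition sl_eigenfunction :: "real \<Rightarrow> real \<Rightarrow> real \<Rightarrow> complex \<Rightarrow> (real \<Rightarrow> complex) \<Rightarrow> bool" where
  "sl_eigenfunction q \<mu> \<beta> \<Lambda> y \<longleftrightarrow>
     sl_solution q \<mu> \<beta> \<Lambda> y \<and> (\<exists>x \<in> q_lattice q. y x \<noteq> 0)"


section \<open>Little q-Jacobi polynomials\<close>

text \<open>\<open>little_q_jacobi q \<alpha> \<beta> n x\<close> is \<open>p\<^sub>n(x; q\<^sup>\<alpha>, q\<^sup>\<beta> | q)\<close>.\<close>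

definition little_q_jacobi :: "real \<Rightarrow> real \<Rightarrow> real \<Rightarrow> nat \<Rightarrow> real \<Rightarrow> real" where
  "little_q_jacobi q \<alpha> \<beta> n x =
     (\<Sum>k\<le>n. qpoch_nat (q powr (- real n)) q k * qpoch_nat (q powr (\<alpha> + \<beta> + real n + 1)) q k /
       (qpoch_nat (q powr (\<alpha> + 1)) q k * qpoch_nat q q k) * (q * x) ^ k)"

definition sl_phi :: "real \<Rightarrow> real \<Rightarrow> real \<Rightarrow> nat \<Rightarrow> real \<Rightarrow> complex" where
  "sl_phi q \<mu> \<beta> n x = of_real (x powr \<mu> * little_q_jacobi q \<mu> \<beta> n x)"

text \<open>In the source this formula has a further factor \<open>\<Gamma>\<^sub>q(\<mu> + 1)\<close> in the denominator. That is a
  slip: \<open>\<phi>\<^sub>0 = x\<^sup>\<mu>\<close> has Caputo derivative \<open>\<Gamma>\<^sub>q(\<mu> + 1)\<close>, and at \<open>x = 1\<close> the equation then forces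
  the value \<open>\<Gamma>\<^sub>q(\<mu> + 1) \<Gamma>\<^sub>q(\<mu> + \<beta> + 1) / \<Gamma>\<^sub>q(\<beta> + 1)\<close>, which is the formula below at \<open>n = 0\<close>.\<close>

definition sl_eigenvalue :: "real \<Rightarrow> real \<Rightarrow> real \<Rightarrow> nat \<Rightarrow> real" where
  "sl_eigenvalue q \<mu> \<beta> n =
     q powr (- real n * \<mu>) * (q_Gamma q (\<mu> + \<beta> + real n + 1) * q_Gamma q (\<mu> + real n + 1)) /
     (q_Gamma q (\<beta> + 1 + real n) * q_Gamma q (real n + 1))"

end

theory Submission
  imports Defs
begin

text \<open>
  Write \<open>H m = (q\<^sup>m\<^sup>+\<^sup>1; q)\<^sub>-\<^sub>\<mu>\<close>. On the lattice, the Caputo derivative at \<open>q\<^sup>n\<close> is, up to a factor, the sum of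
  \<open>H m\<close> against the differences of the function at the points \<open>q\<^sup>n\<^sup>+\<^sup>m\<close> (\<open>caputo_lattice\<close>), and the right-sided
  fractional integral at \<open>q\<^sup>k\<close> is a weighted finite sum of \<open>H (k - n)\<close> over the points \<open>q\<^sup>n\<close> with \<open>n \<le> k\<close>
  (\<open>right_int_lattice\<close>). The same kernel occurs twice, once summed downwards and once upwards, and it
  consists, up to a constant factor, of the coefficients of a q-binomial series.

  Why the \<open>\<phi>\<^sub>n\<close> are eigenfunctions. The q-binomial theorem gives the power rule for the Caputo derivative,
  which turns \<open>x\<^sup>\<mu> p\<^sub>n(x; q\<^sup>\<mu>, q\<^sup>\<beta>)\<close> into a multiple of \<open>p\<^sub>n(x; 1, q\<^sup>\<beta>\<^sup>+\<^sup>\<mu>)\<close>. The convolution identity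
  \<open>q_vandermonde\<close> shows that the right-sided derivative turns \<open>(qx; q)\<close> with index \<open>\<beta> + \<mu> + i\<close> into a multiple of
  \<open>(qx; q)\<close> with index \<open>\<beta> + i\<close>. These two rules use different bases of the polynomials, the
  monomials and the products \<open>(bqx; q)\<^sub>i\<close>. In both bases the second-order
  q-difference operator of the little q-Jacobi polynomials is bidiagonal with the same diagonal, so the
  coefficients of its eigenpolynomial are known in both (\<open>jacobi_change_of_basis\<close>). Expanding
  in one basis before the right-sided derivative and collecting in the other afterwards leads back to
  \<open>p\<^sub>n(x; q\<^sup>\<mu>, q\<^sup>\<beta>)\<close>, and the eigenvalue is the product of the constants.

  Why they are unique. Because the kernels agree, the Caputo derivative and the right-sided
  derivative are adjoint (\<open>fractional_integration_by_parts\<close>), so solutions for different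
  eigenvalues are orthogonal. The numbers \<open>\<lambda>\<^sub>n\<close> are strictly increasing, hence a solution \<open>y\<close> for \<open>\<Lambda>\<close> is orthogonal
  to all \<open>\<phi>\<^sub>n\<close> except possibly one. If \<open>z\<close> is another solution, a suitable \<open>z - c y\<close> is orthogonal to
  that one too. Its weighted values then have vanishing moments, and these values are the coefficients of a
  power series that vanishes at the points \<open>q\<^sup>j\<^sup>+\<^sup>1\<close> accumulating at \<open>0\<close>; so they are zero.
\<close>

section \<open>q-shifted factorials\<close>

text \<open>The coefficient of \<open>z\<^sup>n\<close> in the q-binomial series of \<open>(A z; q)\<^sub>\<infinity> / (z; q)\<^sub>\<infinity>\<close>.\<close>

definition qratio :: "real \<Rightarrow> real \<Rightarrow> nat \<Rightarrow> real" where
  "qratio q A n = qpoch_nat A q n / qpoch_nat q q n"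

lemma qpoch_nat_0 [simp]: "qpoch_nat z q 0 = 1"
  by (simp add: qpoch_nat_def)

lemma qpoch_nat_Suc: "qpoch_nat z q (Suc n) = qpoch_nat z q n * (1 - z * q ^ n)"
  by (simp add: qpoch_nat_def)

lemma qpoch_nat_shift: "qpoch_nat z q (Suc n) = (1 - z) * qpoch_nat (z * q) q n"
  by (simp add: qpoch_nat_def prod.lessThan_Suc_shift mult.assoc del: prod.lessThan_Suc)

lemma qratio_0 [simp]: "qratio q A 0 = 1"
  by (simp add: qratio_def)

locale q_base =
  fixes q :: real
  assumes q0: "0 < q" and q1: "q < 1"
begin

lemma q_powr_less_1: "v > 0 \<Longrightarrow> q powr v < 1"
  using q0 q1 powr_less_mono2 [of v q 1] by simp

lemma q_power_powr: "(q ^ n) powr v = (q powr v) ^ n"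
proof -
  have "(q ^ n) powr v = q powr (real n * v)" using q0 by (simp add: powr_powr flip: powr_realpow)
  also have "\<dots> = (q powr v) ^ n" using q0 powr_realpow [of "q powr v" n] by (simp add: powr_powr mult.commute)
  finally show ?thesis .
qed

lemma convergent_prod_qpoch: "convergent_prod (\<lambda>k. 1 - z * q ^ k)"
proof -
  have "summable (\<lambda>k. norm (1 - z * q ^ k - 1))"
    using q0 q1 by (auto simp: abs_mult intro!: summable_mult summable_geometric)
  then show ?thesis
    by (intro abs_convergent_prod_imp_convergent_prod summable_imp_abs_convergent_prod)
qed

lemma qpoch_nat_LIMSEQ: "(\<lambda>n. qpoch_nat z q n) \<longlonglongrightarrow> qpoch_inf z q"
proof -
  have "(\<lambda>n. \<Prod>i\<le>n. 1 - z * q ^ i) \<longlonglongrightarrow> qpoch_inf z q"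
    unfolding qpoch_inf_def by (rule convergent_prod_LIMSEQ [OF convergent_prod_qpoch])
  then have "(\<lambda>n. qpoch_nat z q (Suc n)) \<longlonglongrightarrow> qpoch_inf z q"
    by (simp add: qpoch_nat_def lessThan_Suc_atMost)
  then show ?thesis by (simp only: filterlim_sequentially_Suc)
qed

lemma qpoch_inf_split: "qpoch_inf z q = qpoch_nat z q n * qpoch_inf (z * q ^ n) q"
proof (induction n)
  case 0
  then show ?case by simp
next
  case (Suc n)
  have rec: "qpoch_inf w q = (1 - w) * qpoch_inf (w * q) q" for w
  proof (rule LIMSEQ_unique)
    show "(\<lambda>n. qpoch_nat w q (Suc n)) \<longlonglongrightarrow> qpoch_inf w q"
      by (rule LIMSEQ_Suc [OF qpoch_nat_LIMSEQ])
    show "(\<lambda>n. qpoch_nat w q (Suc n)) \<longlonglongrightarrow> (1 - w) * qpoch_inf (w * q) q"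
      unfolding qpoch_nat_shift by (intro tendsto_intros qpoch_nat_LIMSEQ)
  qed
  show ?case
    using Suc rec [of "z * q ^ n"] by (simp add: qpoch_nat_Suc ac_simps)
qed

lemma qpoch_inf_Suc: "qpoch_inf z q = (1 - z) * qpoch_inf (z * q) q"
  using qpoch_inf_split [of z 1] by (simp add: qpoch_nat_def)

lemma qpoch_factor_pos:
  assumes "z < 1" shows "1 - z * q ^ k > 0"
proof (cases "z \<le> 0")
  case True
  then have "z * q ^ k \<le> 0" using q0 by (simp add: mult_nonpos_nonneg)
  then show ?thesis by simp
next
  case False
  then have "z * q ^ k \<le> z" using q0 q1 by (simp add: mult_left_le power_le_one)
  then show ?thesis using assms by simp
qed

lemma qpoch_nat_pos: "z < 1 \<Longrightarrow> qpoch_nat z q n > 0"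
  unfolding qpoch_nat_def by (rule prod_pos) (use qpoch_factor_pos in blast)

lemma qpoch_inf_pos: assumes "z < 1" shows "qpoch_inf z q > 0"
proof -
  have "qpoch_inf z q \<noteq> 0"
    unfolding qpoch_inf_def
    by (rule prodinf_nonzero [OF convergent_prod_qpoch])
       (use qpoch_factor_pos [OF assms] in \<open>metis less_irrefl\<close>)
  moreover have "qpoch_inf z q \<ge> 0"
    by (rule LIMSEQ_le_const [OF qpoch_nat_LIMSEQ]) (use qpoch_nat_pos [OF assms] in \<open>auto intro: less_imp_le\<close>)
  ultimately show ?thesis by simp
qed

lemma qpoch_inf_0 [simp]: "qpoch_inf 0 q = 1"
  by (simp add: qpoch_inf_def)

lemma qpoch_0 [simp]: "qpoch 0 q v = 1"
  by (simp add: qpoch_def)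

text \<open>One of the factors is \<open>1 - q\<^sup>-\<^sup>m q\<^sup>m\<close>. This zero cuts the right-sided fractional integrals down to finite sums.\<close>

lemma qpoch_inf_neg_power: "qpoch_inf (1 / q ^ m) q = 0"
  using qpoch_inf_split [of "1 / q ^ m" "Suc m"] q0 by (simp add: qpoch_nat_Suc)

lemma qpoch_neg_power: "qpoch (1 / q ^ m) q v = 0"
  by (simp add: qpoch_def qpoch_inf_neg_power)

lemma qpoch_inf_tendsto_1:
  assumes "z < 1" shows "(\<lambda>n. qpoch_inf (z * q ^ n) q) \<longlonglongrightarrow> 1"
proof -
  have "(\<lambda>n. qpoch_inf z q / qpoch_nat z q n) \<longlonglongrightarrow> qpoch_inf z q / qpoch_inf z q"
    by (intro tendsto_intros qpoch_nat_LIMSEQ) (use qpoch_inf_pos [OF assms] in simp)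
  moreover have "qpoch_inf z q / qpoch_nat z q n = qpoch_inf (z * q ^ n) q" for n
    using qpoch_inf_split [of z n] qpoch_nat_pos [OF assms, of n] by (simp add: field_simps)
  ultimately show ?thesis using qpoch_inf_pos [OF assms] by simp
qed

text \<open>On the lattice, factorials of real index are q-binomial coefficients; through this formula the
  q-binomial theorem and the q-Vandermonde identity evaluate the fractional integrals.\<close>

lemma qpoch_lattice:
  assumes "v > -1"
  shows "qpoch (q * q ^ n) q v
       = qpoch_inf q q / qpoch_inf (q powr (v + 1)) q * qratio q (q powr (v + 1)) n"
proof -
  have l: "q powr (v + 1) < 1" by (rule q_powr_less_1) (use assms in simp)
  have e: "q * q ^ n * q powr v = q powr (v + 1) * q ^ n"
    using q0 by (simp add: powr_add)
  show ?thesis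
    using qpoch_inf_split [of q n] qpoch_inf_split [of "q powr (v + 1)" n]
      qpoch_nat_pos [OF l, of n] qpoch_nat_pos [OF q1, of n] qpoch_inf_pos [OF l]
    unfolding qpoch_def e qratio_def by (auto simp: field_simps)
qed

lemma qpoch_lattice_pos:
  assumes "v > -1" shows "qpoch (q * q ^ n) q v > 0"
proof -
  have l: "q powr (v + 1) < 1" by (rule q_powr_less_1) (use assms in simp)
  show ?thesis unfolding qpoch_lattice [OF assms] qratio_def
    by (simp add: qpoch_inf_pos qpoch_nat_pos l q1)
qed

lemma qpoch_lattice_tendsto_1:
  assumes "v > -1" shows "(\<lambda>n. qpoch (q * q ^ n) q v) \<longlonglongrightarrow> 1"
proof -
  have l: "q powr (v + 1) < 1" by (rule q_powr_less_1) (use assms in simp)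
  have e: "q * q ^ n * q powr v = q powr (v + 1) * q ^ n" for n
    using q0 by (simp add: powr_add)
  have "(\<lambda>n. qpoch (q * q ^ n) q v) \<longlonglongrightarrow> 1 / 1"
    unfolding qpoch_def e by (intro tendsto_intros qpoch_inf_tendsto_1 l q1) simp
  then show ?thesis by simp
qed

lemma qpoch_lattice_bounded:
  assumes "v > -1" obtains C where "\<And>n. \<bar>qpoch (q * q ^ n) q v\<bar> \<le> C"
  using Bseq_eq_bounded convergent_imp_Bseq [OF convergentI [OF qpoch_lattice_tendsto_1 [OF assms]]]
  by (metis Bseq_def real_norm_def)

lemma qpoch_add_nat:
  "v > -1 \<Longrightarrow> x \<le> 1 \<Longrightarrow> qpoch (q * x) q (v + real i)
    = qpoch (q * x) q v * qpoch_nat (q powr v * q * x) q i"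
proof -
  assume v: "v > -1" and x: "x \<le> 1"
  have l: "q powr (v + 1) * x < 1"
  proof (cases "x \<le> 0")
    case True
    then have "q powr (v + 1) * x \<le> 0" by (simp add: mult_nonneg_nonpos)
    then show ?thesis by simp
  next
    case False
    then have "q powr (v + 1) * x \<le> q powr (v + 1)" using x by (simp add: mult_left_le)
    also have "\<dots> < 1" by (rule q_powr_less_1) (use v in simp)
    finally show ?thesis .
  qed
  have e: "q * x * q powr v = q powr (v + 1) * x" "q powr v * q * x = q powr (v + 1) * x"
    "q * x * q powr (v + real i) = q powr (v + 1) * x * q ^ i"
    using q0 by (simp_all add: powr_add powr_realpow ac_simps)
  show ?thesis
    unfolding qpoch_def e
    using qpoch_inf_split [of "q powr (v + 1) * x" i] qpoch_inf_pos [OF l] qpoch_nat_pos [OF l, of i]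
    by auto
qed

section \<open>The q-binomial theorem\<close>

lemma qratio_Suc:
  "(1 - q ^ Suc n) * qratio q A (Suc n) = (1 - A * q ^ n) * qratio q A n"
  using qpoch_nat_pos [OF q1, of n] qpoch_factor_pos [OF q1, of n]
  by (simp add: qratio_def qpoch_nat_Suc field_simps)

lemma qratio_bounded: obtains C where "\<And>n. \<bar>qratio q A n\<bar> \<le> C"
proof -
  have "(\<lambda>n. qratio q A n) \<longlonglongrightarrow> qpoch_inf A q / qpoch_inf q q"
    unfolding qratio_def by (intro tendsto_intros qpoch_nat_LIMSEQ) (use qpoch_inf_pos [OF q1] in simp)
  then show ?thesis using that
    by (metis Bseq_def convergentI convergent_imp_Bseq real_norm_def)
qed

lemma qratio_summable:
  assumes "\<bar>z\<bar> < 1" shows "summable (\<lambda>n. qratio q A n * z ^ n)"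
proof -
  obtain C where C: "\<And>n. \<bar>qratio q A n\<bar> \<le> C" using qratio_bounded by blast
  show ?thesis
  proof (rule summable_comparison_test')
    show "summable (\<lambda>n. C * \<bar>z\<bar> ^ n)" using assms by (intro summable_mult summable_geometric) simp
    show "norm (qratio q A n * z ^ n) \<le> C * \<bar>z\<bar> ^ n" for n
      using C [of n] by (simp add: abs_mult power_abs mult_right_mono)
  qed
qed

text \<open>Comparing coefficients gives \<open>(1 - w) F(w) = (1 - A w) F(q w)\<close> for the sum \<open>F\<close>; iterating it along
  \<open>z q\<^sup>N\<close> and using that \<open>F\<close> is continuous at \<open>0\<close> produces the two infinite products.\<close>

theorem q_binomial:
  assumes z: "\<bar>z\<bar> < 1"
  shows "(\<lambda>n. qratio q A n * z ^ n) sums (qpoch_inf (A * z) q / qpoch_inf z q)"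
proof -
  define F where "F w = (\<Sum>n. qratio q A n * w ^ n)" for w
  have F: "(\<lambda>n. qratio q A n * w ^ n) sums F w" if "\<bar>w\<bar> < 1" for w
    unfolding F_def by (rule summable_sums [OF qratio_summable [OF that]])
  have step: "(1 - w) * F w = (1 - A * w) * F (w * q)" if w: "\<bar>w\<bar> < 1" for w
  proof -
    have wq: "\<bar>w * q\<bar> < 1"
      using w q0 q1 by (simp add: abs_mult) (meson abs_ge_zero less_imp_le mult_left_le order_le_less_trans)
    have "(\<lambda>n. qratio q A n * w ^ n - qratio q A n * (w * q) ^ n) sums (F w - F (w * q))"
      by (intro sums_diff F w wq)
    then have "(\<lambda>n. (1 - q ^ n) * qratio q A n * w ^ n) sums (F w - F (w * q))"
      by (simp add: algebra_simps power_mult_distrib)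
    then have "(\<lambda>n. (1 - q ^ Suc n) * qratio q A (Suc n) * w ^ Suc n) sums (F w - F (w * q))"
      by (subst sums_Suc_iff) simp
    moreover have "(\<lambda>n. w * (qratio q A n * w ^ n) - A * w * (qratio q A n * (w * q) ^ n))
        sums (w * F w - A * w * F (w * q))"
      by (intro sums_diff sums_mult F w wq)
    moreover have "(1 - q ^ Suc n) * qratio q A (Suc n) * w ^ Suc n
       = w * (qratio q A n * w ^ n) - A * w * (qratio q A n * (w * q) ^ n)" for n
      unfolding qratio_Suc by (simp add: algebra_simps power_mult_distrib)
    ultimately have "F w - F (w * q) = w * F w - A * w * F (w * q)"
      using sums_unique2 by fastforce
    then show ?thesis by (simp add: algebra_simps)
  qed
  have small: "\<bar>z * q ^ N\<bar> < 1" for N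
    using z q0 q1 by (simp add: abs_mult)
      (meson abs_ge_zero less_imp_le mult_left_le order_le_less_trans power_le_one zero_le_power)
  have iter: "qpoch_nat z q N * F z = qpoch_nat (A * z) q N * F (z * q ^ N)" for N
  proof (induction N)
    case (Suc N)
    show ?case
      using Suc step [OF small [of N]] by (simp add: qpoch_nat_Suc ac_simps) (metis mult.assoc)
  qed (simp add: F_def)
  have "(F \<longlongrightarrow> qratio q A 0) (at 0)"
    by (rule powser_limit_0 [of 1]) (use F in auto)
  moreover have "F 0 = qratio q A 0"
    using F [of 0] by (simp add: powser_sums_zero_iff)
  ultimately have "isCont F 0" by (simp add: isCont_def)
  moreover have "(\<lambda>N. z * q ^ N) \<longlonglongrightarrow> z * 0"
    using q0 q1 by (intro tendsto_intros LIMSEQ_realpow_zero) auto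
  ultimately have "(\<lambda>N. F (z * q ^ N)) \<longlonglongrightarrow> F 0"
    using isCont_tendsto_compose [of 0 F "\<lambda>N. z * q ^ N"] by simp
  then have "(\<lambda>N. qpoch_nat (A * z) q N * F (z * q ^ N)) \<longlonglongrightarrow> qpoch_inf (A * z) q * 1"
    using \<open>F 0 = qratio q A 0\<close> by (intro tendsto_mult qpoch_nat_LIMSEQ) simp
  moreover have "(\<lambda>N. qpoch_nat z q N * F z) \<longlonglongrightarrow> qpoch_inf z q * F z"
    by (intro tendsto_mult qpoch_nat_LIMSEQ tendsto_const)
  ultimately have "qpoch_inf z q * F z = qpoch_inf (A * z) q"
    using LIMSEQ_unique unfolding iter by fastforce
  moreover have "qpoch_inf z q > 0" using z by (intro qpoch_inf_pos) simp
  ultimately have "F z = qpoch_inf (A * z) q / qpoch_inf z q" by (simp add: field_simps)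
  then show ?thesis using F [OF z] by simp
qed

text \<open>The coefficients of \<open>z\<^sup>k\<close> in \<open>(A z)\<^sub>\<infinity> / (z)\<^sub>\<infinity> \<cdot> (A B z)\<^sub>\<infinity> / (A z)\<^sub>\<infinity> = (A B z)\<^sub>\<infinity> / (z)\<^sub>\<infinity>\<close>. The proof
  shows that the left-hand side satisfies the first-order recurrence of the right-hand side, splitting
  \<open>1 - q\<^sup>k\<^sup>+\<^sup>1\<close> as \<open>(1 - q\<^sup>k\<^sup>+\<^sup>1\<^sup>-\<^sup>n) + q\<^sup>k\<^sup>+\<^sup>1\<^sup>-\<^sup>n (1 - q\<^sup>n)\<close> so that each part lowers one of the two indices.\<close>

lemma q_vandermonde:
  "(\<Sum>n\<le>k. A ^ n * qratio q A (k - n) * qratio q B n) = qratio q (A * B) k"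
proof (induction k)
  case (Suc k)
  let ?h = "qratio q A" and ?g = "qratio q B"
  define t where "t n = A ^ n * ?h (Suc k - n) * ?g n" for n
  have "(1 - q ^ Suc k) * (\<Sum>n\<le>Suc k. t n)
      = (\<Sum>n\<le>Suc k. (1 - q ^ (Suc k - n)) * t n) + (\<Sum>n\<le>Suc k. q ^ (Suc k - n) * (1 - q ^ n) * t n)"
    unfolding sum_distrib_left sum.distrib [symmetric]
  proof (rule sum.cong [OF refl])
    fix n assume "n \<in> {..Suc k}"
    then have "q ^ Suc k = q ^ (Suc k - n) * q ^ n" by (simp flip: power_add)
    then show "(1 - q ^ Suc k) * t n = (1 - q ^ (Suc k - n)) * t n + q ^ (Suc k - n) * (1 - q ^ n) * t n"
      by (simp add: algebra_simps)
  qed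
  also have "(\<Sum>n\<le>Suc k. (1 - q ^ (Suc k - n)) * t n)
      = (\<Sum>n\<le>k. (1 - A * q ^ (k - n)) * (A ^ n * ?h (k - n) * ?g n))"
  proof -
    have "(1 - q ^ (Suc k - n)) * t n = (1 - A * q ^ (k - n)) * (A ^ n * ?h (k - n) * ?g n)"
      if "n \<le> k" for n
    proof -
      have "(1 - q ^ (Suc k - n)) * t n = A ^ n * ((1 - q ^ Suc (k - n)) * ?h (Suc (k - n))) * ?g n"
        unfolding t_def using that by (simp add: Suc_diff_le del: power_Suc)
      then show ?thesis unfolding qratio_Suc by (simp add: ac_simps)
    qed
    then show ?thesis by simp
  qed
  also have "(\<Sum>n\<le>Suc k. q ^ (Suc k - n) * (1 - q ^ n) * t n)
      = (\<Sum>n\<le>k. A * q ^ (k - n) * (1 - B * q ^ n) * (A ^ n * ?h (k - n) * ?g n))"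
  proof -
    have "q ^ (k - n) * (1 - q ^ Suc n) * t (Suc n)
        = A * q ^ (k - n) * (1 - B * q ^ n) * (A ^ n * ?h (k - n) * ?g n)" for n
    proof -
      note power_Suc [simp del]
      have "q ^ (k - n) * (1 - q ^ Suc n) * t (Suc n)
          = A * q ^ (k - n) * A ^ n * ?h (k - n) * ((1 - q ^ Suc n) * ?g (Suc n))"
        unfolding t_def by (simp add: power_Suc [of A])
      then show ?thesis unfolding qratio_Suc by (simp add: ac_simps)
    qed
    then have "(\<Sum>n\<le>k. q ^ (k - n) * (1 - q ^ Suc n) * t (Suc n))
        = (\<Sum>n\<le>k. A * q ^ (k - n) * (1 - B * q ^ n) * (A ^ n * ?h (k - n) * ?g n))"
      by (intro sum.cong refl)
    then show ?thesis by (subst sum.atMost_Suc_shift) (simp del: sum.atMost_Suc power_Suc)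
  qed
  also have "(\<Sum>n\<le>k. (1 - A * q ^ (k - n)) * (A ^ n * ?h (k - n) * ?g n))
      + (\<Sum>n\<le>k. A * q ^ (k - n) * (1 - B * q ^ n) * (A ^ n * ?h (k - n) * ?g n))
      = (1 - A * B * q ^ k) * (\<Sum>n\<le>k. A ^ n * ?h (k - n) * ?g n)"
    unfolding sum_distrib_left sum.distrib [symmetric]
  proof (rule sum.cong [OF refl])
    fix n assume "n \<in> {..k}"
    then have "q ^ k = q ^ (k - n) * q ^ n" by (simp flip: power_add)
    then show "(1 - A * q ^ (k - n)) * (A ^ n * ?h (k - n) * ?g n)
        + A * q ^ (k - n) * (1 - B * q ^ n) * (A ^ n * ?h (k - n) * ?g n)
        = (1 - A * B * q ^ k) * (A ^ n * ?h (k - n) * ?g n)"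
      by (simp add: algebra_simps)
  qed
  finally have "(1 - q ^ Suc k) * (\<Sum>n\<le>Suc k. t n) = (1 - q ^ Suc k) * qratio q (A * B) (Suc k)"
    unfolding qratio_Suc Suc.IH by simp
  moreover have "1 - q ^ Suc k \<noteq> 0" using qpoch_factor_pos [OF q1, of k] by simp
  ultimately show ?case unfolding t_def by simp
qed simp

lemma q_Gamma_pos: "v > 0 \<Longrightarrow> q_Gamma q v > 0"
  unfolding q_Gamma_def using q1 by (simp add: qpoch_inf_pos q_powr_less_1)

lemma q_Gamma_1 [simp]: "q_Gamma q 1 = 1"
  unfolding q_Gamma_def using q0 q1 qpoch_inf_pos [OF q1] by simp

lemma q_Gamma_add_nat:
  assumes "v > 0"
  shows "q_Gamma q (v + real n) = q_Gamma q v * qpoch_nat (q powr v) q n / (1 - q) ^ n"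
proof -
  have l: "q powr v < 1" using assms by (rule q_powr_less_1)
  have e: "q powr (v + real n) = q powr v * q ^ n" using q0 by (simp add: powr_add powr_realpow)
  have "(1 - q) powr (1 - (v + real n)) = (1 - q) powr ((1 - v) - real n)" by (simp add: algebra_simps)
  also have "\<dots> = (1 - q) powr (1 - v) / (1 - q) ^ n"
    using q1 by (simp add: powr_diff powr_realpow)
  finally show ?thesis
    unfolding q_Gamma_def e
    using qpoch_inf_split [of "q powr v" n] qpoch_inf_pos [OF l] qpoch_nat_pos [OF l, of n] by auto
qed

section \<open>The operators on the lattice\<close>

text \<open>The common kernel of the left- and right-sided fractional integrals of order \<open>1 - \<mu>\<close>.\<close>

definition frac_kernel :: "real \<Rightarrow> nat \<Rightarrow> real" where
  "frac_kernel \<mu> m = qpoch (q * q ^ m) q (- \<mu>)"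

lemma frac_kernel_eq:
  assumes "\<mu> < 1"
  shows "frac_kernel \<mu> m
    = qpoch_inf q q / qpoch_inf (q powr (1 - \<mu>)) q * qratio q (q powr (1 - \<mu>)) m"
  using qpoch_lattice [of "- \<mu>" m] assms by (simp add: frac_kernel_def)

lemma frac_kernel_bounded:
  assumes "\<mu> < 1" obtains C where "\<And>m. \<bar>frac_kernel \<mu> m\<bar> \<le> C"
  using qpoch_lattice_bounded [of "- \<mu>" thesis] assms unfolding frac_kernel_def by force

lemma frac_kernel_sums:
  assumes "\<mu> < 1" "\<bar>z\<bar> < 1"
  shows "(\<lambda>m. frac_kernel \<mu> m * z ^ m) sums
    (qpoch_inf q q / qpoch_inf (q powr (1 - \<mu>)) q * (qpoch_inf (q powr (1 - \<mu>) * z) q / qpoch_inf z q))"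
  unfolding frac_kernel_eq [OF assms(1)] mult.assoc
  by (intro sums_mult q_binomial assms)

lemma left_integrand_lattice:
  "(q ^ n * q ^ m) *\<^sub>R left_integrand q (1 - \<mu>) (q_deriv q f) (q ^ n) (q ^ n * q ^ m)
    = (1 / (1 - q)) *\<^sub>R (frac_kernel \<mu> m *\<^sub>R (f (q ^ (n + m)) - f (q ^ Suc (n + m))))"
  using q0 q1 unfolding left_integrand_def q_deriv_def frac_kernel_def
  by (simp add: power_add divide_simps ac_simps)

lemma caputo_lattice:
  assumes "(\<lambda>m. frac_kernel \<mu> m *\<^sub>R (f (q ^ (n + m)) - f (q ^ Suc (n + m)))) sums s"
  shows "left_int_exists q (1 - \<mu>) (q_deriv q f) (q ^ n)"
    and "caputo q \<mu> f (q ^ n) = ((q powr - \<mu>) ^ n / q_Gamma q (1 - \<mu>)) *\<^sub>R s"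
proof -
  have *: "(\<lambda>m. (q ^ n * q ^ m) *\<^sub>R left_integrand q (1 - \<mu>) (q_deriv q f) (q ^ n) (q ^ n * q ^ m))
      sums ((1 / (1 - q)) *\<^sub>R s)"
    unfolding left_integrand_lattice by (rule sums_scaleR_right [OF assms])
  then show "left_int_exists q (1 - \<mu>) (q_deriv q f) (q ^ n)"
    unfolding left_int_exists_def jackson_summable_def by (rule sums_summable)
  show "caputo q \<mu> f (q ^ n) = ((q powr - \<mu>) ^ n / q_Gamma q (1 - \<mu>)) *\<^sub>R s"
    using q1 unfolding caputo_def left_int_def jackson_def sums_unique [OF *, symmetric]
    by (simp add: q_power_powr)
qed

lemma right_integrand_lattice:
  "q ^ n *\<^sub>R right_integrand q (1 - \<mu>) f (q ^ k) (q ^ n)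
    = (if n \<le> k then ((q powr (1 - \<mu>)) ^ n * frac_kernel \<mu> (k - n)) *\<^sub>R f (q ^ n) else 0)"
proof -
  have p: "q ^ n * (q ^ n) powr (1 - \<mu> - 1) = (q powr (1 - \<mu>)) ^ n"
    using q0 by (simp add: powr_diff powr_minus divide_simps flip: q_power_powr)
  show ?thesis
  proof (cases "n \<le> k")
    case True
    then have "q * q ^ k / q ^ n = q * q ^ (k - n)" using q0 by (simp add: power_diff)
    then have "qpoch (q * q ^ k / q ^ n) q (1 - \<mu> - 1) = frac_kernel \<mu> (k - n)"
      by (simp add: frac_kernel_def)
    with True show ?thesis
      unfolding right_integrand_def by (simp add: p [symmetric] mult.assoc)
  next
    case False
    then have "q * q ^ k / q ^ n = 1 / q ^ (n - Suc k)"
      using q0 by (simp add: power_diff)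
    with False show ?thesis
      unfolding right_integrand_def by (simp add: qpoch_neg_power)
  qed
qed

text \<open>All the factorials here have the form \<open>(q\<^sup>-\<^sup>m; q)\<close>, so they vanish.\<close>

lemma right_integrand_beyond:
  "right_integrand q (1 - \<mu>) f (1 / q) (q ^ n) = 0"
  "right_integrand q (1 - \<mu>) f (q ^ k) (q * q ^ k * q ^ n) = 0"
proof -
  have "q * q ^ k / (q * q ^ k * q ^ n) = 1 / q ^ n" using q0 by simp
  then show "right_integrand q (1 - \<mu>) f (q ^ k) (q * q ^ k * q ^ n) = 0"
    unfolding right_integrand_def by (simp add: qpoch_neg_power)
  show "right_integrand q (1 - \<mu>) f (1 / q) (q ^ n) = 0"
    unfolding right_integrand_def using q0 by (simp add: qpoch_neg_power)
qed

text \<open>The boundary condition at \<open>1 / q\<close> follows from this, and so does the missing boundary term at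
  \<open>x = 1\<close> in the summation by parts below.\<close>

lemma right_int_beyond:
  "right_int_exists q (1 - \<mu>) f (1 / q)" "right_int q (1 - \<mu>) f (1 / q) = 0"
  using q0 by (simp_all add: right_int_exists_def jackson_summable_def right_int_def jackson_def
      right_integrand_beyond)

lemma right_int_lattice:
  "right_int_exists q (1 - \<mu>) f (q ^ k)"
  "right_int q (1 - \<mu>) f (q ^ k) = ((1 - q) / q_Gamma q (1 - \<mu>)) *\<^sub>R
     (\<Sum>n\<le>k. ((q powr (1 - \<mu>)) ^ n * frac_kernel \<mu> (k - n)) *\<^sub>R f (q ^ n))"
proof -
  define t where "t n = ((q powr (1 - \<mu>)) ^ n * frac_kernel \<mu> (k - n)) *\<^sub>R f (q ^ n)" for n
  have "(1 * q ^ n) *\<^sub>R right_integrand q (1 - \<mu>) f (q ^ k) (1 * q ^ n) = (if n \<in> {..k} then t n else 0)" for n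
    by (simp add: right_integrand_lattice t_def)
  then have "(\<lambda>n. (1 * q ^ n) *\<^sub>R right_integrand q (1 - \<mu>) f (q ^ k) (1 * q ^ n)) sums (\<Sum>n\<le>k. t n)"
    using sums_If_finite_set [of "{..k}" t] by simp
  then have 1: "jackson_summable q (right_integrand q (1 - \<mu>) f (q ^ k)) 1"
    "jackson q (right_integrand q (1 - \<mu>) f (q ^ k)) 1 = (1 - q) *\<^sub>R (\<Sum>n\<le>k. t n)"
    unfolding jackson_summable_def jackson_def by (auto dest: sums_summable sums_unique)
  have 2: "jackson_summable q (right_integrand q (1 - \<mu>) f (q ^ k)) (q * q ^ k)"
    "jackson q (right_integrand q (1 - \<mu>) f (q ^ k)) (q * q ^ k) = 0"
    by (simp_all add: jackson_summable_def jackson_def right_integrand_beyond)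
  show "right_int_exists q (1 - \<mu>) f (q ^ k)"
    using 1 2 by (simp add: right_int_exists_def)
  show "right_int q (1 - \<mu>) f (q ^ k) = ((1 - q) / q_Gamma q (1 - \<mu>)) *\<^sub>R
     (\<Sum>n\<le>k. ((q powr (1 - \<mu>)) ^ n * frac_kernel \<mu> (k - n)) *\<^sub>R f (q ^ n))"
    using 1 2 by (simp add: right_int_def t_def)
qed

text \<open>At \<open>x = 0\<close> the kernel degenerates to \<open>1\<close> and the sum becomes infinite.\<close>

lemma right_int_origin:
  assumes "(\<lambda>n. (q powr (1 - \<mu>)) ^ n *\<^sub>R f (q ^ n)) sums s"
  shows "right_int_exists q (1 - \<mu>) f 0"
    and "right_int q (1 - \<mu>) f 0 = ((1 - q) / q_Gamma q (1 - \<mu>)) *\<^sub>R s"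
proof -
  have p: "q ^ n * (q ^ n) powr (1 - \<mu> - 1) = (q powr (1 - \<mu>)) ^ n" for n
    using q0 by (simp add: powr_diff powr_minus divide_simps flip: q_power_powr)
  have "(\<lambda>n. (1 * q ^ n) *\<^sub>R right_integrand q (1 - \<mu>) f 0 (1 * q ^ n)) sums s"
    using assms unfolding right_integrand_def by (simp add: p [symmetric])
  then have 1: "jackson_summable q (right_integrand q (1 - \<mu>) f 0) 1"
    "jackson q (right_integrand q (1 - \<mu>) f 0) 1 = (1 - q) *\<^sub>R s"
    unfolding jackson_summable_def jackson_def by (auto dest: sums_summable sums_unique)
  have 2: "jackson_summable q (right_integrand q (1 - \<mu>) f 0) (q * 0)"
    "jackson q (right_integrand q (1 - \<mu>) f 0) (q * 0) = 0"
    by (simp_all add: jackson_summable_def jackson_def)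
  show "right_int_exists q (1 - \<mu>) f 0"
    using 1 2 by (simp add: right_int_exists_def)
  show "right_int q (1 - \<mu>) f 0 = ((1 - q) / q_Gamma q (1 - \<mu>)) *\<^sub>R s"
    using 1 2 by (simp add: right_int_def)
qed

text \<open>The factor \<open>-1/q\<close> turns the \<open>q\<^sup>-\<^sup>1\<close>-derivative into a backward difference quotient.\<close>

lemma right_RL_lattice:
  "right_RL q \<mu> f (q ^ k)
    = (right_int q (1 - \<mu>) f (q ^ k) - right_int q (1 - \<mu>) f (q ^ k / q)) /\<^sub>R ((1 - q) * q ^ k)"
proof -
  have "- (1 / q) / ((1 - 1 / q) * q ^ k) = 1 / ((1 - q) * q ^ k)"
    using q0 q1 by (simp add: divide_simps)
  then have "- (1 / q) * inverse ((1 - 1 / q) * q ^ k) = inverse ((1 - q) * q ^ k)"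
    by (simp add: divide_inverse)
  then show ?thesis
    unfolding right_RL_def q_inv_deriv_def scaleR_scaleR by simp
qed

section \<open>Power functions\<close>

text \<open>The bookkeeping common to the two integral evaluations below: infinite products \<open>Q, A, B, C\<close> and powers
  \<open>p\<^sub>i\<close> of \<open>1 - q\<close> in a quotient of q-Gamma values.\<close>

lemma gamma_quotient:
  fixes Q A B C :: real
  assumes "p1 * p2 = p3 * r" "p3 \<noteq> 0" "r \<noteq> 0" "Q \<noteq> 0" "A \<noteq> 0" "B \<noteq> 0" "C \<noteq> 0"
  shows "Q / A * p1 / r * (Q / B * p2 / (Q / C * p3)) = Q / A * (C / B)"
proof -
  have "Q / A * p1 / r * (Q / B * p2 / (Q / C * p3)) = Q / A * (C / B) * ((p1 * p2) / (p3 * r))"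
    using assms(2-) by (simp add: field_simps)
  then show ?thesis using assms by simp
qed

text \<open>The power rule for \<open>x\<^sup>\<mu>\<^sup>+\<^sup>j\<close>: its differences form a geometric sequence, so the sum is a q-binomial series.\<close>

lemma caputo_power_sums:
  assumes \<mu>: "0 < \<mu>" "\<mu> < 1"
  shows "(\<lambda>m. frac_kernel \<mu> m * ((q powr (\<mu> + real j)) ^ (n + m) - (q powr (\<mu> + real j)) ^ Suc (n + m)))
    sums (q_Gamma q (1 - \<mu>) * (q_Gamma q (\<mu> + real j + 1) / q_Gamma q (real j + 1))
      * (q powr (\<mu> + real j)) ^ n)"
proof -
  define z where "z = q powr (\<mu> + real j)"
  have z: "0 < z" "z < 1" using \<mu> q0 by (auto simp: z_def intro!: q_powr_less_1)
  have e: "q powr (1 - \<mu>) * z = q powr (real j + 1)" "q powr (\<mu> + real j + 1) = z * q"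
    using q0 by (simp_all add: z_def powr_add powr_diff)
  have l: "z * q < 1" "q powr (real j + 1) < 1" "q powr (1 - \<mu>) < 1"
    unfolding e(2) [symmetric] by (rule q_powr_less_1; use \<mu> in simp)+
  let ?S = "qpoch_inf q q / qpoch_inf (q powr (1 - \<mu>)) q * (qpoch_inf (q powr (1 - \<mu>) * z) q / qpoch_inf z q)"
  have "(\<lambda>m. z ^ n * (1 - z) * (frac_kernel \<mu> m * z ^ m)) sums (z ^ n * (1 - z) * ?S)"
    using z by (intro sums_mult frac_kernel_sums \<mu>) simp
  moreover have "z ^ n * (1 - z) * (frac_kernel \<mu> m * z ^ m)
      = frac_kernel \<mu> m * (z ^ (n + m) - z ^ Suc (n + m))" for m
    by (simp add: power_add algebra_simps)
  moreover have "(1 - z) / qpoch_inf z q = 1 / qpoch_inf (z * q) q"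
    using z qpoch_inf_Suc [of z] by simp
  then have "z ^ n * (1 - z) * ?S = z ^ n * (qpoch_inf q q / qpoch_inf (q powr (1 - \<mu>)) q
      * (qpoch_inf (q powr (real j + 1)) q / qpoch_inf (z * q) q))"
    unfolding e by (simp add: divide_inverse ac_simps)
  moreover have "q_Gamma q (1 - \<mu>) * (q_Gamma q (\<mu> + real j + 1) / q_Gamma q (real j + 1))
      = qpoch_inf q q / qpoch_inf (q powr (1 - \<mu>)) q
      * (qpoch_inf (q powr (real j + 1)) q / qpoch_inf (z * q) q)"
  proof -
    have "(1 - q) powr (1 - (1 - \<mu>)) * (1 - q) powr (1 - (\<mu> + real j + 1)) = (1 - q) powr (1 - (real j + 1))"
      by (simp flip: powr_add)
    moreover have "(1 - q) powr (1 - (real j + 1)) > 0" using q1 by simp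
    ultimately show ?thesis
      using gamma_quotient [of _ _ "(1 - q) powr (1 - (real j + 1))" 1 "qpoch_inf q q"]
        qpoch_inf_pos [OF q1] qpoch_inf_pos [OF l(1)] qpoch_inf_pos [OF l(2)] qpoch_inf_pos [OF l(3)]
      unfolding q_Gamma_def e(2) by simp
  qed
  ultimately show ?thesis unfolding z_def [symmetric] by (metis (no_types, lifting) mult.commute sums_cong)
qed

text \<open>The right-sided integral of order \<open>1 - \<mu>\<close> raises the index of \<open>(qx; q)\<^sub>b\<close> by \<open>1 - \<mu>\<close>: at lattice points
  this is the q-Vandermonde identity, at the origin its limit, the q-binomial theorem.\<close>

lemma right_int_qpoch_sum:
  assumes \<mu>: "0 < \<mu>" "\<mu> < 1" and b: "b > -1"
  shows "(\<Sum>n\<le>k. (q powr (1 - \<mu>)) ^ n * frac_kernel \<mu> (k - n) * qpoch (q * q ^ n) q b)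
    = q_Gamma q (1 - \<mu>) / (1 - q) * (q_Gamma q (b + 1) / q_Gamma q (b + 2 - \<mu>))
      * qpoch (q * q ^ k) q (b + 1 - \<mu>)" (is ?fin)
    and "(\<lambda>n. (q powr (1 - \<mu>)) ^ n * qpoch (q * q ^ n) q b) sums
      (q_Gamma q (1 - \<mu>) / (1 - q) * (q_Gamma q (b + 1) / q_Gamma q (b + 2 - \<mu>)))" (is ?inf)
proof -
  define A where "A = q powr (1 - \<mu>)"
  define B where "B = q powr (b + 1)"
  have AB: "q powr (b + 2 - \<mu>) = A * B"
    by (simp add: A_def B_def algebra_simps flip: powr_add)
  have l: "A < 1" "B < 1" "A * B < 1"
    unfolding AB [symmetric] unfolding A_def B_def by (rule q_powr_less_1; use \<mu> b in simp)+
  have A0: "0 < A" using q0 by (simp add: A_def)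
  have ker: "frac_kernel \<mu> m = qpoch_inf q q / qpoch_inf A q * qratio q A m" for m
    unfolding A_def by (rule frac_kernel_eq [OF \<mu>(2)])
  have qb: "qpoch (q * q ^ n) q b = qpoch_inf q q / qpoch_inf B q * qratio q B n" for n
    unfolding B_def by (rule qpoch_lattice [OF b])
  have qc: "qpoch (q * q ^ n) q (b + 1 - \<mu>) = qpoch_inf q q / qpoch_inf (A * B) q * qratio q (A * B) n" for n
    using qpoch_lattice [of "b + 1 - \<mu>" n] \<mu> b AB by (simp add: add.commute add_diff_eq)
  have gam: "q_Gamma q (1 - \<mu>) / (1 - q) * (q_Gamma q (b + 1) / q_Gamma q (b + 2 - \<mu>))
      = qpoch_inf q q / qpoch_inf A q * (qpoch_inf (A * B) q / qpoch_inf B q)"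
  proof -
    have "(1 - q) powr (1 - (1 - \<mu>)) * (1 - q) powr (1 - (b + 1))
        = (1 - q) powr (1 - (b + 2 - \<mu>) + 1)"
      by (simp add: algebra_simps flip: powr_add)
    also have "\<dots> = (1 - q) powr (1 - (b + 2 - \<mu>)) * (1 - q)"
      unfolding powr_add using q1 by simp
    finally show ?thesis
      unfolding q_Gamma_def AB A_def [symmetric] B_def [symmetric]
      using q1 qpoch_inf_pos [OF q1] qpoch_inf_pos [OF l(1)] qpoch_inf_pos [OF l(2)]
        qpoch_inf_pos [OF l(3)] by (intro gamma_quotient) auto
  qed
  have "(\<Sum>n\<le>k. A ^ n * frac_kernel \<mu> (k - n) * qpoch (q * q ^ n) q b)
      = qpoch_inf q q / qpoch_inf A q * (qpoch_inf q q / qpoch_inf B q)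
        * (\<Sum>n\<le>k. A ^ n * qratio q A (k - n) * qratio q B n)"
    unfolding sum_distrib_left ker qb by (intro sum.cong refl) (simp add: ac_simps)
  also have "\<dots> = qpoch_inf q q / qpoch_inf A q * (qpoch_inf (A * B) q / qpoch_inf B q)
      * qpoch (q * q ^ k) q (b + 1 - \<mu>)"
    unfolding q_vandermonde qc using qpoch_inf_pos [OF l(3)] by simp
  finally show ?fin unfolding gam A_def by simp
  have "(\<lambda>n. qpoch_inf q q / qpoch_inf B q * (qratio q B n * A ^ n)) sums
      (qpoch_inf q q / qpoch_inf B q * (qpoch_inf (B * A) q / qpoch_inf A q))"
    using A0 l by (intro sums_mult q_binomial) simp
  then show ?inf unfolding gam qb A_def [symmetric] by (simp add: ac_simps)
qed

lemma qpoch_difference: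
  assumes c: "c > -1"
  shows "qpoch (q * q ^ k) q (c + 1) - qpoch (q ^ k) q (c + 1)
    = (1 - q powr (c + 1)) * q ^ k * qpoch (q * q ^ k) q c"
proof -
  define w where "w = q ^ k * q powr (c + 1)"
  have "w \<le> q powr (c + 1)" using q0 q1 by (simp add: w_def mult_left_le_one_le power_le_one)
  also have "\<dots> < 1" by (rule q_powr_less_1) (use c in simp)
  finally have w: "1 - w \<noteq> 0" by simp
  have e: "q * q ^ k * q powr (c + 1) = w * q" "q ^ k * q powr (c + 1) = w" "q * q ^ k * q powr c = w"
    using q0 by (simp_all add: w_def powr_add)
  show ?thesis
  proof -
    define a P where "a = qpoch_inf (q * q ^ k) q" and "P = qpoch_inf (w * q) q"
    have 1: "qpoch_inf (q ^ k) q = (1 - q ^ k) * a" "qpoch_inf w q = (1 - w) * P"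
      using qpoch_inf_Suc [of w] qpoch_inf_Suc [of "q ^ k"] by (simp_all add: a_def P_def mult.commute)
    have "a / P = ((1 - w) * a) / ((1 - w) * P)" using w by simp
    then have "a / P - (1 - q ^ k) * a / ((1 - w) * P) = (q ^ k - w) * a / ((1 - w) * P)"
      by (simp add: diff_divide_distrib [symmetric] left_diff_distrib)
    then show ?thesis
      unfolding qpoch_def e 1 a_def [symmetric] P_def [symmetric]
      by (simp add: w_def algebra_simps)
  qed
qed

section \<open>Derivative at the origin\<close>

text \<open>The value \<open>g(q\<^sup>k) - g(0)\<close> is the telescoping sum of the differences further down the lattice. If the
  difference quotients tend to \<open>L\<close>, comparison with a geometric series gives the derivative at \<open>0\<close>; the factor \<open>-q\<close>
  arises because the quotient is normalised by \<open>q\<^sup>k\<^sup>+\<^sup>1\<close> and runs towards the origin.\<close>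

lemma q_deriv_at_0_from_lattice:
  fixes g :: "real \<Rightarrow> complex"
  assumes lim: "(\<lambda>k. g (q ^ k)) \<longlonglongrightarrow> g 0"
    and R: "(\<lambda>k. (g (q ^ Suc k) - g (q ^ k)) /\<^sub>R ((1 - q) * q ^ Suc k)) \<longlonglongrightarrow> L"
  shows "has_q_deriv_at_0 q g (- q *\<^sub>R L)"
proof -
  \<comment> \<open>Subtracting the expected linear part reduces the claim to \<open>L = 0\<close>.\<close>
  define A where "A k = g (q ^ k) - g 0 + (q * q ^ k) *\<^sub>R L" for k
  have A_Suc: "A (Suc k) - A k = ((1 - q) * q ^ Suc k) *\<^sub>R
      ((g (q ^ Suc k) - g (q ^ k)) /\<^sub>R ((1 - q) * q ^ Suc k) - L)" for k
  proof -
    have "((1 - q) * q ^ Suc k) *\<^sub>R ((g (q ^ Suc k) - g (q ^ k)) /\<^sub>R ((1 - q) * q ^ Suc k))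
        = g (q ^ Suc k) - g (q ^ k)"
      unfolding scaleR_scaleR using q0 q1 by (subst right_inverse) auto
    then show ?thesis
      by (simp only: A_def scaleR_right_diff_distrib) (simp add: algebra_simps)
  qed
  have "(\<lambda>k. g (q ^ k) - g 0 + (q * q ^ k) *\<^sub>R L) \<longlonglongrightarrow> g 0 - g 0 + (q * 0) *\<^sub>R L"
    using q0 q1 by (intro tendsto_intros lim LIMSEQ_realpow_zero) auto
  then have A_lim: "A \<longlonglongrightarrow> 0" by (simp add: A_def [abs_def])
  have "(\<lambda>k. A k /\<^sub>R q ^ k) \<longlonglongrightarrow> 0"
  proof (rule LIMSEQ_I)
    fix e :: real assume e: "e > 0"
    then obtain K where K: "\<And>k. k \<ge> K \<Longrightarrow>
        norm ((g (q ^ Suc k) - g (q ^ k)) /\<^sub>R ((1 - q) * q ^ Suc k) - L) < e"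
      using LIMSEQ_D [OF R] by blast
    have "norm (A k /\<^sub>R q ^ k - 0) < e" if k: "k \<ge> K" for k
    proof -
      have step: "norm (A (Suc i) - A i) \<le> e * (q ^ Suc i - q ^ Suc (Suc i))" if "i \<ge> K" for i
      proof -
        have "norm (A (Suc i) - A i) \<le> \<bar>(1 - q) * q ^ Suc i\<bar> * e"
          unfolding A_Suc norm_scaleR by (intro mult_left_mono less_imp_le [OF K [OF that]]) simp
        also have "\<bar>(1 - q) * q ^ Suc i\<bar> = (1 - q) * q ^ Suc i"
          by (rule abs_of_nonneg) (use q0 q1 in simp)
        finally show ?thesis by (simp add: algebra_simps)
      qed
      have "norm (A (k + j) - A k) \<le> e * (q ^ Suc k - q ^ Suc (k + j))" for j
      proof (induction j)
        case (Suc j)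
        have "norm (A (k + Suc j) - A k) \<le> norm (A (Suc (k + j)) - A (k + j)) + norm (A (k + j) - A k)"
          using norm_triangle_ineq [of "A (Suc (k + j)) - A (k + j)" "A (k + j) - A k"] by simp
        then show ?case using Suc step [of "k + j"] k by (simp add: algebra_simps)
      qed simp
      moreover have "e * (q ^ Suc k - q ^ Suc (k + j)) \<le> e * q ^ Suc k" for j
        using e q0 by simp
      ultimately have "norm (A (k + j) - A k) \<le> e * q ^ Suc k" for j
        by (meson order_trans)
      moreover have "(\<lambda>j. norm (A (j + k) - A k)) \<longlonglongrightarrow> norm (0 - A k)"
        by (intro tendsto_intros LIMSEQ_ignore_initial_segment A_lim)
      ultimately have "norm (A k) \<le> e * q ^ Suc k"
        by (intro LIMSEQ_le_const2 [of "\<lambda>j. norm (A (j + k) - A k)"]) (auto simp: add.commute)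
      also have "\<dots> < e * q ^ k" using e q0 q1 by simp
      finally show ?thesis using q0 by (simp add: divide_simps mult.commute)
    qed
    then show "\<exists>K. \<forall>k\<ge>K. norm (A k /\<^sub>R q ^ k - 0) < e" by blast
  qed
  then have "(\<lambda>k. A k /\<^sub>R q ^ k - q *\<^sub>R L) \<longlonglongrightarrow> 0 - q *\<^sub>R L"
    by (intro tendsto_intros)
  moreover have "A k /\<^sub>R q ^ k - q *\<^sub>R L = (g (q ^ k) - g 0) /\<^sub>R q ^ k" for k
    using q0 by (simp add: A_def scaleR_right_distrib)
  ultimately show ?thesis by (simp add: has_q_deriv_at_0_def)
qed

section \<open>Fractional integration by parts\<close>

text \<open>Fubini for a double series with a geometric majorant: by rows or by diagonals.\<close>

lemma sum_by_diagonals: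
  fixes a :: "nat \<Rightarrow> nat \<Rightarrow> complex"
  assumes bound: "\<And>n m. norm (a n m) \<le> C * (x ^ n * y ^ m)"
    and x: "0 \<le> x" "x < 1" and y: "0 \<le> y" "y < 1"
  shows "\<exists>s. (\<lambda>k. \<Sum>n\<le>k. a n (k - n)) sums s \<and> (\<lambda>n. \<Sum>m. a n m) sums s"
proof -
  have C: "C \<ge> 0" using order_trans [OF norm_ge_zero bound [of 0 0]] by simp
  have geo: "((\<lambda>n. z ^ n) has_sum 1 / (1 - z)) (UNIV :: nat set)" if "0 \<le> z" "z < 1" for z :: real
    by (rule norm_summable_imp_has_sum) (use that in \<open>auto simp: norm_power intro: summable_geometric geometric_sums\<close>)
  have "(\<lambda>(n, m). C * (x ^ n * y ^ m)) summable_on (UNIV \<times> UNIV)"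
  proof (rule summable_on_SigmaI [where g = "\<lambda>n. C * (x ^ n * (1 / (1 - y)))"])
    show "((\<lambda>m. case (n, m) of (n, m) \<Rightarrow> C * (x ^ n * y ^ m)) has_sum C * (x ^ n * (1 / (1 - y)))) UNIV" for n
      unfolding prod.case by (intro has_sum_cmult_right geo y)
    show "(\<lambda>n. C * (x ^ n * (1 / (1 - y)))) summable_on UNIV"
      by (intro summable_on_cmult_right summable_on_cmult_left) (use geo [OF x] in \<open>auto simp: summable_on_def\<close>)
  qed (use C x y in auto)
  then have "(\<lambda>p. norm (case p of (n, m) \<Rightarrow> a n m)) summable_on (UNIV \<times> UNIV)"
    by (rule Infinite_Sum.abs_summable_on_comparison_test') (auto intro: bound)
  then have "(\<lambda>(n, m). a n m) summable_on (UNIV \<times> UNIV)"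
    by (rule abs_summable_summable)
  then obtain s where s: "((\<lambda>(n, m). a n m) has_sum s) (UNIV \<times> UNIV)"
    by (auto simp: summable_on_def)
  have rows: "((\<lambda>m. case (n, m) of (n, m) \<Rightarrow> a n m) has_sum (\<Sum>m. a n m)) UNIV" for n
  proof -
    have "summable (\<lambda>m. norm (a n m))"
    proof (rule summable_comparison_test')
      show "summable (\<lambda>m. C * (x ^ n * y ^ m))"
        using y by (intro summable_mult summable_geometric) simp
    qed (use bound in simp)
    then show ?thesis
      unfolding prod.case
      by (intro norm_summable_imp_has_sum summable_sums) (auto dest: summable_norm_cancel)
  qed
  have "(\<lambda>n. \<Sum>m. a n m) sums s"
    by (rule has_sum_imp_sums [OF has_sum_SigmaD [OF s rows]])
  moreover have "((\<lambda>(k, n). a n (k - n)) has_sum s) (Sigma UNIV (\<lambda>k. {..k}))"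
    using s by (subst has_sum_reindex_bij_witness
        [where i = "\<lambda>(n, m). (n + m, n)" and j = "\<lambda>(k, n). (n, k - n)"
          and h = "\<lambda>(n, m). a n m" and T = "UNIV \<times> UNIV" and s' = s]) auto
  then have "((\<lambda>k. \<Sum>n\<le>k. a n (k - n)) has_sum s) UNIV"
    by (rule has_sum_SigmaD) simp
  then have "(\<lambda>k. \<Sum>n\<le>k. a n (k - n)) sums s"
    by (rule has_sum_imp_sums)
  ultimately show ?thesis by blast
qed

text \<open>A function of size \<open>O(x\<^sup>\<mu>)\<close> has a bounded Caputo derivative: the prefactor \<open>x\<^sup>-\<^sup>\<mu>\<close> is compensated.\<close>

lemma caputo_of_power_bound:
  assumes \<mu>: "0 < \<mu>" "\<mu> < 1"
    and g: "\<And>n. norm (g (q ^ n) :: complex) \<le> C * (q powr \<mu>) ^ n"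
  shows "summable (\<lambda>m. norm (frac_kernel \<mu> m *\<^sub>R (g (q ^ (n + m)) - g (q ^ Suc (n + m)))))"
    and "\<exists>B. \<forall>n. norm (caputo q \<mu> g (q ^ n)) \<le> B"
proof -
  define r where "r = q powr \<mu>"
  have r: "0 < r" "r < 1" using q0 \<mu> by (auto simp: r_def q_powr_less_1)
  obtain K where K: "\<And>m. \<bar>frac_kernel \<mu> m\<bar> \<le> K" using frac_kernel_bounded [OF \<mu>(2)] by blast
  have "C \<ge> 0" using order_trans [OF norm_ge_zero g [of 0]] by simp
  have bnd: "norm (frac_kernel \<mu> m *\<^sub>R (g (q ^ (n + m)) - g (q ^ Suc (n + m)))) \<le> 2 * K * C * r ^ n * r ^ m" for n m
  proof -
    have "norm (g (q ^ (n + m)) - g (q ^ Suc (n + m))) \<le> C * r ^ (n + m) + C * r ^ Suc (n + m)"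
      using norm_triangle_ineq4 g unfolding r_def by (meson add_mono order_trans)
    also have "\<dots> \<le> C * r ^ (n + m) + C * r ^ (n + m)"
      using r \<open>C \<ge> 0\<close> by (intro add_left_mono mult_left_mono) (simp_all add: mult_left_le_one_le)
    finally have "norm (g (q ^ (n + m)) - g (q ^ Suc (n + m))) \<le> 2 * C * (r ^ n * r ^ m)"
      by (simp add: power_add mult.assoc mult.commute [of "r ^ m"])
    then have "norm (frac_kernel \<mu> m *\<^sub>R (g (q ^ (n + m)) - g (q ^ Suc (n + m)))) \<le> K * (2 * C * (r ^ n * r ^ m))"
      unfolding norm_scaleR by (intro mult_mono K) (use K [of 0] in auto)
    then show ?thesis by (simp add: ac_simps)
  qed
  have geo: "(\<lambda>m. 2 * K * C * r ^ n * r ^ m) sums (2 * K * C * r ^ n * (1 / (1 - r)))" for n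
    using r by (intro sums_mult geometric_sums) simp
  have sm: "summable (\<lambda>m. norm (frac_kernel \<mu> m *\<^sub>R (g (q ^ (n + m)) - g (q ^ Suc (n + m)))))" for n
    by (rule summable_comparison_test' [OF sums_summable [OF geo [of n]]]) (use bnd in simp)
  then show "summable (\<lambda>m. norm (frac_kernel \<mu> m *\<^sub>R (g (q ^ (n + m)) - g (q ^ Suc (n + m)))))" .
  have G: "q_Gamma q (1 - \<mu>) > 0" using \<mu> by (simp add: q_Gamma_pos)
  have "norm (caputo q \<mu> g (q ^ n)) \<le> 2 * K * C / (1 - r) / q_Gamma q (1 - \<mu>)" for n
  proof -
    have "(q powr - \<mu>) ^ n * r ^ n = 1"
      using q0 by (simp add: r_def flip: power_mult_distrib powr_add)
    have "norm (caputo q \<mu> g (q ^ n)) = (q powr - \<mu>) ^ n / q_Gamma q (1 - \<mu>)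
        * norm (\<Sum>m. frac_kernel \<mu> m *\<^sub>R (g (q ^ (n + m)) - g (q ^ Suc (n + m))))"
      unfolding caputo_lattice(2) [OF summable_sums [OF summable_norm_cancel [OF sm]]] norm_scaleR
      using G by (simp add: abs_of_pos)
    also have "\<dots> \<le> (q powr - \<mu>) ^ n / q_Gamma q (1 - \<mu>) * (2 * K * C * r ^ n * (1 / (1 - r)))"
    proof (rule mult_left_mono)
      show "norm (\<Sum>m. frac_kernel \<mu> m *\<^sub>R (g (q ^ (n + m)) - g (q ^ Suc (n + m))))
          \<le> 2 * K * C * r ^ n * (1 / (1 - r))"
        unfolding sums_unique [OF geo [of n]]
        by (intro order_trans [OF summable_norm [OF sm]] suminf_le bnd sm sums_summable [OF geo])
    qed (use G in simp)
    also have "\<dots> = ((q powr - \<mu>) ^ n * r ^ n) * (2 * K * C / (1 - r) / q_Gamma q (1 - \<mu>))"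
      by (simp add: ac_simps)
    finally show ?thesis unfolding \<open>(q powr - \<mu>) ^ n * r ^ n = 1\<close> by simp
  qed
  then show "\<exists>B. \<forall>n. norm (caputo q \<mu> g (q ^ n)) \<le> B" by blast
qed

text \<open>Summation by parts moves the backward difference of the fractional integral onto \<open>g\<close>; then both sides are
  the same double series over \<open>H m f(q\<^sup>n) (g(q\<^sup>n\<^sup>+\<^sup>m) - g(q\<^sup>n\<^sup>+\<^sup>m\<^sup>+\<^sup>1))\<close>, summed along diagonals on the left and along
  rows on the right. The growth conditions on \<open>f\<close> and \<open>g\<close> give the geometric majorant and remove the boundary term.\<close>

theorem fractional_integration_by_parts:
  assumes \<mu>: "0 < \<mu>" "\<mu> < 1"
    and f: "\<And>n. norm (f (q ^ n) :: complex) \<le> B"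
    and g: "\<And>n. norm (g (q ^ n) :: complex) \<le> C * (q powr \<mu>) ^ n"
  shows "\<exists>s. (\<lambda>k. q ^ k *\<^sub>R (right_RL q \<mu> f (q ^ k) * g (q ^ k))) sums s
    \<and> (\<lambda>k. q ^ k *\<^sub>R (f (q ^ k) * caputo q \<mu> g (q ^ k))) sums s"
proof -
  define r where "r = q powr \<mu>"
  define Z where "Z = q powr (1 - \<mu>)"
  define c where "c = q_Gamma q (1 - \<mu>)"
  have r: "0 < r" "r < 1" and Z: "0 < Z" "Z < 1"
    using q0 \<mu> by (auto simp: r_def Z_def q_powr_less_1)
  have c: "c > 0" using \<mu> by (simp add: c_def q_Gamma_pos)
  obtain K where K: "\<And>m. \<bar>frac_kernel \<mu> m\<bar> \<le> K" using frac_kernel_bounded [OF \<mu>(2)] by blast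
  have B0: "B \<ge> 0" using f [of 0] norm_ge_zero order_trans by blast
  have K0: "K \<ge> 0" using K [of 0] by linarith
  have C0: "C \<ge> 0" using order_trans [OF norm_ge_zero g [of 0]] by simp
  define d where "d k = g (q ^ k) - g (q ^ Suc k)" for k
  have d: "norm (d k) \<le> 2 * C * r ^ k" for k
  proof -
    have "norm (d k) \<le> C * r ^ k + C * r ^ Suc k"
      using norm_triangle_ineq4 g unfolding r_def d_def by (meson add_mono order_trans)
    also have "\<dots> \<le> C * r ^ k + C * r ^ k"
      using r C0 by (intro add_left_mono mult_left_mono) (simp_all add: mult_left_le_one_le)
    finally show ?thesis by simp
  qed
  define a where "a n m = (Z ^ n * frac_kernel \<mu> m) *\<^sub>R (f (q ^ n) * d (n + m))" for n m
  have bound: "norm (a n m) \<le> K * B * (2 * C) * (Z ^ n * r ^ m)" for n m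
  proof -
    have "norm (f (q ^ n) * d (n + m)) \<le> B * (2 * C * r ^ (n + m))"
      unfolding norm_mult by (intro mult_mono f d B0) simp
    also have "\<dots> \<le> B * (2 * C * r ^ m)"
      using B0 C0 r by (intro mult_left_mono power_decreasing) auto
    finally have 1: "norm (f (q ^ n) * d (n + m)) \<le> B * (2 * C * r ^ m)" .
    have 2: "\<bar>Z ^ n * frac_kernel \<mu> m\<bar> \<le> Z ^ n * K"
      using Z K by (simp add: abs_mult)
    show ?thesis
      unfolding a_def norm_scaleR using mult_mono [OF 2 1] Z K0 by (simp add: ac_simps)
  qed
  obtain s where s: "(\<lambda>k. \<Sum>n\<le>k. a n (k - n)) sums s" "(\<lambda>n. \<Sum>m. a n m) sums s"
    using sum_by_diagonals [OF bound] r Z by force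
  have right: "(\<lambda>k. q ^ k *\<^sub>R (f (q ^ k) * caputo q \<mu> g (q ^ k))) sums ((1 / c) *\<^sub>R s)"
  proof -
    have "q ^ n *\<^sub>R (f (q ^ n) * caputo q \<mu> g (q ^ n)) = (1 / c) *\<^sub>R (\<Sum>m. a n m)" for n
    proof -
      have Zn: "q ^ n * (q powr - \<mu>) ^ n = Z ^ n"
        using q0 by (simp add: Z_def powr_diff powr_minus divide_inverse flip: power_mult_distrib)
      have sm: "summable (\<lambda>m. frac_kernel \<mu> m *\<^sub>R (g (q ^ (n + m)) - g (q ^ Suc (n + m))))"
        by (rule summable_norm_cancel [OF caputo_of_power_bound(1) [OF \<mu> g]])
      have "(\<Sum>m. a n m) = (\<Sum>m. (Z ^ n *\<^sub>R f (q ^ n)) * (frac_kernel \<mu> m *\<^sub>R (g (q ^ (n + m)) - g (q ^ Suc (n + m)))))"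
        by (simp add: a_def d_def mult.commute)
      also have "\<dots> = (Z ^ n *\<^sub>R f (q ^ n)) * (\<Sum>m. frac_kernel \<mu> m *\<^sub>R (g (q ^ (n + m)) - g (q ^ Suc (n + m))))"
        by (rule suminf_mult [OF sm])
      finally show ?thesis
        unfolding caputo_lattice(2) [OF summable_sums [OF sm]] c_def
        by (simp flip: Zn add: ac_simps)
    qed
    then show ?thesis using sums_scaleR_right [OF s(2), of "1 / c"] by simp
  qed
  define S where "S k = (\<Sum>n\<le>k. (Z ^ n * frac_kernel \<mu> (k - n)) *\<^sub>R f (q ^ n))" for k
  \<comment> \<open>The sum at the preceding lattice point; at \<open>x = 1\<close> that point is \<open>1 / q\<close>, where the integral vanishes.\<close>
  define S' where "S' k = (if k = 0 then 0 else S (k - 1))" for k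
  have diag: "(\<Sum>n\<le>k. a n (k - n)) = S k * d k" for k
    unfolding S_def a_def sum_distrib_right by (intro sum.cong refl) simp
  have RL: "q ^ k *\<^sub>R (right_RL q \<mu> f (q ^ k) * g (q ^ k)) = (1 / c) *\<^sub>R ((S k - S' k) * g (q ^ k))" for k
  proof -
    have "right_int q (1 - \<mu>) f (q ^ k / q) = ((1 - q) / c) *\<^sub>R S' k"
    proof (cases k)
      case (Suc j)
      then show ?thesis
        using q0 right_int_lattice(2) [of \<mu> f j] by (simp add: S'_def S_def Z_def c_def)
    qed (simp add: right_int_beyond S'_def)
    moreover have "right_int q (1 - \<mu>) f (q ^ k) = ((1 - q) / c) *\<^sub>R S k"
      using right_int_lattice(2) [of \<mu> f k] by (simp add: S_def Z_def c_def)
    ultimately have "right_RL q \<mu> f (q ^ k) = (((1 - q) / c) *\<^sub>R (S k - S' k)) /\<^sub>R ((1 - q) * q ^ k)"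
      unfolding right_RL_lattice by (simp add: scaleR_right_diff_distrib)
    moreover have "q ^ k * (inverse ((1 - q) * q ^ k) * ((1 - q) / c)) = 1 / c"
      using q0 q1 by (simp add: divide_simps)
    ultimately show ?thesis by (simp del: inverse_mult_distrib)
  qed
  have parts: "(\<Sum>k<N. (S k - S' k) * g (q ^ k)) = (\<Sum>k<N. S k * d k) + S' N * g (q ^ N)" for N
    by (induction N) (simp_all add: S'_def d_def algebra_simps)
  have S_bound: "norm (S' N) \<le> K * B * (1 / (1 - Z))" for N
  proof (cases N)
    case 0
    then show ?thesis using K0 B0 Z by (simp add: S'_def)
  next
    case (Suc k)
    have "norm (S k) \<le> (\<Sum>n\<le>k. K * B * Z ^ n)"
      unfolding S_def
    proof (rule sum_norm_le)
      fix n assume "n \<in> {..k}"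
      have "\<bar>Z ^ n * frac_kernel \<mu> (k - n)\<bar> * norm (f (q ^ n)) \<le> (Z ^ n * K) * B"
        using Z K0 by (intro mult_mono f) (auto simp: abs_mult K)
      then show "norm ((Z ^ n * frac_kernel \<mu> (k - n)) *\<^sub>R f (q ^ n)) \<le> K * B * Z ^ n"
        by (simp add: ac_simps)
    qed
    also have "\<dots> \<le> K * B * (1 / (1 - Z))"
      unfolding sum_distrib_left [symmetric]
    proof (rule mult_left_mono)
      show "(\<Sum>n\<le>k. Z ^ n) \<le> 1 / (1 - Z)"
        using Z sum_le_suminf [of "\<lambda>n. Z ^ n" "{..k}"] suminf_geometric [of Z]
        by (simp add: summable_geometric)
    qed (use K0 B0 in simp)
    finally show ?thesis using Suc by (simp add: S'_def)
  qed
  have "(\<lambda>N. S' N * g (q ^ N)) \<longlonglongrightarrow> 0"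
  proof (rule Lim_null_comparison)
    show "\<forall>\<^sub>F N in sequentially. norm (S' N * g (q ^ N)) \<le> (K * B * (1 / (1 - Z))) * (C * r ^ N)"
      unfolding norm_mult r_def using S_bound g
      by (intro always_eventually allI mult_mono) (use K0 B0 Z in auto)
    show "(\<lambda>N. (K * B * (1 / (1 - Z))) * (C * r ^ N)) \<longlonglongrightarrow> 0"
      using r by (intro tendsto_mult_right_zero LIMSEQ_realpow_zero) auto
  qed
  moreover have "(\<lambda>N. \<Sum>k<N. S k * d k) \<longlonglongrightarrow> s"
    using s(1) by (simp add: sums_def diag)
  ultimately have "(\<lambda>k. (S k - S' k) * g (q ^ k)) sums s"
    unfolding sums_def parts using tendsto_add by fastforce
  then have "(\<lambda>k. q ^ k *\<^sub>R (right_RL q \<mu> f (q ^ k) * g (q ^ k))) sums ((1 / c) *\<^sub>R s)"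
    unfolding RL by (rule sums_scaleR_right)
  with right show ?thesis by blast
qed

section \<open>Vanishing moments\<close>

text \<open>The moments are the values at \<open>q\<^sup>j\<^sup>+\<^sup>1\<close> of the power series with coefficients \<open>W k\<close>. Once the first \<open>N\<close>
  coefficients are known to vanish, dividing by \<open>x\<^sup>N\<close> and letting \<open>j\<close> grow shows that the next one does.\<close>

lemma vanishing_moments:
  fixes W :: "nat \<Rightarrow> complex"
  assumes W: "\<And>k. norm (W k) \<le> C" and moments: "\<And>j. (\<lambda>k. W k * of_real ((q ^ k) ^ Suc j)) sums 0"
  shows "W k = 0"
proof (induction k rule: less_induct)
  case (less N)
  define F where "F x = (\<Sum>k. W (k + N) * x ^ k)" for x
  have F: "(\<lambda>k. W (k + N) * x ^ k) sums F x" if "norm x < 1" for x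
    unfolding F_def
  proof (rule summable_sums, rule summable_comparison_test')
    show "summable (\<lambda>k. C * norm x ^ k)" using that by (intro summable_mult summable_geometric) simp
    show "norm (W (k + N) * x ^ k) \<le> C * norm x ^ k" for k
      unfolding norm_mult norm_power by (intro mult_right_mono W) simp
  qed
  have F0: "F (of_real q ^ Suc j) = 0" for j
  proof -
    let ?x = "complex_of_real q ^ Suc j"
    have x: "norm ?x < 1"
      using q0 q1 power_strict_decreasing [of 0 "Suc j" q] by (simp add: norm_power norm_mult del: power_Suc)
    have "(\<lambda>k. W (k + N) * of_real ((q ^ (k + N)) ^ Suc j)) sums
        (0 - (\<Sum>i<N. W i * of_real ((q ^ i) ^ Suc j)))"
      using sums_split_initial_segment [OF moments] by blast
    then have "(\<lambda>k. W (k + N) * of_real ((q ^ (k + N)) ^ Suc j)) sums 0"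
      using less by simp
    moreover have "W (k + N) * of_real ((q ^ (k + N)) ^ Suc j) = ?x ^ N * (W (k + N) * ?x ^ k)" for k
    proof -
      have "of_real ((q ^ (k + N)) ^ Suc j) = ?x ^ N * ?x ^ k"
        by (simp add: power_add ac_simps flip: power_mult of_real_power)
          (simp add: power_mult_distrib ac_simps flip: power_mult)
      then show ?thesis by (simp add: ac_simps)
    qed
    ultimately have "(\<lambda>k. ?x ^ N * (W (k + N) * ?x ^ k)) sums 0"
      by (simp only:)
    then have "?x ^ N * F ?x = 0"
      by (rule sums_unique2 [OF sums_mult [OF F [OF x]]])
    then show ?thesis using q0 by simp
  qed
  have "(F \<longlongrightarrow> W (0 + N)) (at 0)"
    by (rule powser_limit_0 [of 1 "\<lambda>k. W (k + N)"]) (use F in auto)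
  moreover have "filterlim (\<lambda>j. complex_of_real q ^ Suc j) (at 0) sequentially"
    using q0 q1 by (intro filterlim_atI LIMSEQ_Suc [OF LIMSEQ_power_zero]) auto
  ultimately have "(\<lambda>j. F (of_real q ^ Suc j)) \<longlonglongrightarrow> W (0 + N)"
    by (rule filterlim_compose)
  then show ?case unfolding F0 by (simp add: LIMSEQ_const_iff)
qed

section \<open>Little q-Jacobi polynomials in two bases\<close>

text \<open>With \<open>p = aq\<close> and \<open>s = abq\<close> these are the coefficients of \<open>p\<^sub>n(x; a, b | q)\<close> in the monomials, and with
  \<open>p = bq\<close>, up to one common factor, its coefficients in the products \<open>(bqx; q)\<^sub>i\<close>.\<close>

definition jacobi_coeff :: "real \<Rightarrow> real \<Rightarrow> nat \<Rightarrow> nat \<Rightarrow> real" where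
  "jacobi_coeff p s n k = qpoch_nat (1 / q ^ n) q k * qpoch_nat (s * q ^ n) q k
     / (qpoch_nat p q k * qpoch_nat q q k) * q ^ k"

text \<open>The eigenvalue at degree \<open>k\<close> of the q-difference operator
  \<open>f \<mapsto> (a (bqx - 1) (f(qx) - f(x)) + (x - 1) (f(x/q) - f(x))) / x\<close>, where \<open>s = abq\<close>.\<close>

definition jacobi_eig :: "real \<Rightarrow> nat \<Rightarrow> real" where
  "jacobi_eig s k = (1 / q ^ k - 1) * (1 - s * q ^ k)"

text \<open>The factor \<open>(1 - q\<^sup>k\<^sup>-\<^sup>n) (1 - s q\<^sup>n\<^sup>+\<^sup>k)\<close> in the ratio of consecutive coefficients is \<open>q\<^sup>k\<close> times a
  difference of eigenvalues, so the recurrence is that of an eigenvector of a bidiagonal operator.\<close>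

lemma jacobi_coeff_Suc:
  assumes "p < 1"
  shows "(1 / q ^ Suc k - 1) * (1 - p * q ^ k) * jacobi_coeff p s n (Suc k) = (jacobi_eig s k - jacobi_eig s n) * jacobi_coeff p s n k"
proof -
  have "(1 - q ^ k / q ^ n) * (1 - s * q ^ n * q ^ k) = q ^ k * (jacobi_eig s k - jacobi_eig s n)"
    using q0 by (simp add: jacobi_eig_def field_simps)
  moreover have "jacobi_coeff p s n (Suc k) * (1 - q ^ Suc k) * (1 - p * q ^ k)
      = q * ((1 - q ^ k / q ^ n) * (1 - s * q ^ n * q ^ k)) * jacobi_coeff p s n k"
  proof -
    have "1 - q ^ Suc k \<noteq> 0" "1 - p * q ^ k \<noteq> 0"
      using qpoch_factor_pos [OF q1, of k] qpoch_factor_pos [OF assms, of k] by auto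
    then show ?thesis
      unfolding jacobi_coeff_def qpoch_nat_Suc by simp
  qed
  moreover have "(1 / q ^ Suc k - 1) * (1 - p * q ^ k) * jacobi_coeff p s n (Suc k)
      = jacobi_coeff p s n (Suc k) * (1 - q ^ Suc k) * (1 - p * q ^ k) / q ^ Suc k"
    using q0 by (simp add: field_simps)
  ultimately show ?thesis using q0 by simp
qed

lemma jacobi_coeff_0 [simp]: "jacobi_coeff p s n 0 = 1"
  by (simp add: jacobi_coeff_def)

lemma jacobi_coeff_top_nonzero:
  assumes "p < 1" "s * q ^ n < 1"
  shows "jacobi_coeff p s n n \<noteq> 0"
proof -
  have "1 - 1 / q ^ n * q ^ j \<noteq> 0" if "j < n" for j
  proof -
    have "q ^ n < q ^ j" by (rule power_strict_decreasing [OF that q0 q1])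
    then have "1 < 1 / q ^ n * q ^ j" using q0 by (simp add: less_divide_eq)
    then show ?thesis by (metis less_irrefl right_minus_eq)
  qed
  then have "qpoch_nat (1 / q ^ n) q n \<noteq> 0"
    unfolding qpoch_nat_def prod_zero_iff [OF finite_lessThan] by blast
  then show ?thesis
    using qpoch_nat_pos [OF assms(1), of n] qpoch_nat_pos [OF assms(2), of n] qpoch_nat_pos [OF q1, of n] q0
    by (simp add: jacobi_coeff_def)
qed

text \<open>The q-difference operator, multiplied by \<open>x\<close>, is bidiagonal in the basis \<open>(R x; q)\<^sub>i\<close> with \<open>R = bq\<close>.\<close>

lemma q_difference_operator_qpoch_nat:
  "a * (R * x - 1) * (qpoch_nat (R * (q * x)) q (Suc i) - qpoch_nat (R * x) q (Suc i))
     + (x - 1) * (qpoch_nat (R * (x / q)) q (Suc i) - qpoch_nat (R * x) q (Suc i))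
   = x * (jacobi_eig (a * R) (Suc i) * qpoch_nat (R * x) q (Suc i)
       - (1 / q ^ Suc i - 1) * (1 - R * q ^ i) * qpoch_nat (R * x) q i)"
proof -
  define e where "e = qpoch_nat (R * x) q i"
  define y where "y = q ^ i"
  have y: "y > 0" using q0 by (simp add: y_def)
  have 1: "qpoch_nat (R * x) q (Suc i) = e * (1 - R * x * y)"
    by (simp add: e_def y_def qpoch_nat_Suc)
  have 2: "(1 - R * x) * qpoch_nat (R * (q * x)) q (Suc i) = e * (1 - R * x * y) * (1 - R * x * y * q)"
    using qpoch_nat_shift [of "R * x" q "Suc i"] 1
    by (simp add: qpoch_nat_Suc [of _ q "Suc i"] y_def ac_simps)
  have 3: "qpoch_nat (R * (x / q)) q (Suc i) = (1 - R * x / q) * e"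
    using qpoch_nat_shift [of "R * (x / q)" q i] q0 by (simp add: e_def)
  have 4: "a * (R * x - 1) * (qpoch_nat (R * (q * x)) q (Suc i) - e * (1 - R * x * y))
      = - a * ((1 - R * x) * qpoch_nat (R * (q * x)) q (Suc i)) - a * (R * x - 1) * (e * (1 - R * x * y))"
    by (simp add: algebra_simps)
  show ?thesis
    unfolding 1 3 4 2 jacobi_eig_def power_Suc y_def [symmetric] e_def [symmetric]
    using q0 y by (simp add: field_simps)
qed

text \<open>By \<open>q_difference_operator_qpoch_nat\<close> and the recurrence of its coefficients, the left-hand side is an
  eigenpolynomial of the q-difference operator. Comparing powers of \<open>x\<close> in the eigenvalue equation gives the recurrence for its
  monomial coefficients, which the little q-Jacobi coefficients satisfy as well. The two polynomials
  are therefore proportional, and the leading coefficients determine the factor.\<close>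

lemma jacobi_change_of_basis:
  assumes aq: "a * q < 1" and R: "R < 1" and s: "a * R * q ^ n < 1"
  shows "(\<Sum>i\<le>n. jacobi_coeff R (a * R) n i * qpoch_nat (R * x) q i)
    = qpoch_nat (a * q) q n / qpoch_nat R q n * (\<Prod>j<n. - R * q ^ j)
      * (\<Sum>k\<le>n. jacobi_coeff (a * q) (a * R) n k * x ^ k)"
proof -
  let ?s = "a * R"
  define E where "E i = (\<Prod>j<i. [:1, - R * q ^ j:])" for i
  define P where "P = (\<Sum>i\<le>n. smult (jacobi_coeff R ?s n i) (E i))"
  have E: "poly (E i) x = qpoch_nat (R * x) q i" for i x
    by (simp add: E_def qpoch_nat_def poly_prod algebra_simps)
  have P: "poly P x = (\<Sum>i\<le>n. jacobi_coeff R ?s n i * qpoch_nat (R * x) q i)" for x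
    by (simp add: P_def poly_sum E)
  have "a * (R * x - 1) * (poly P (q * x) - poly P x) + (x - 1) * (poly P (x / q) - poly P x)
      = x * (jacobi_eig ?s n * poly P x)" for x
  proof -
    define T where "T i = a * (R * x - 1) * (qpoch_nat (R * (q * x)) q i - qpoch_nat (R * x) q i)
       + (x - 1) * (qpoch_nat (R * (x / q)) q i - qpoch_nat (R * x) q i)" for i
    define B where "B i = (1 / q ^ i - 1) * (1 - R * q ^ (i - 1)) * qpoch_nat (R * x) q (i - 1)" for i
    have T: "T i = x * (jacobi_eig ?s i * qpoch_nat (R * x) q i - B i)" for i
    proof (cases i)
      case (Suc j)
      then show ?thesis
        using q_difference_operator_qpoch_nat [of a R x j] by (simp add: T_def B_def)
    qed (simp add: T_def B_def jacobi_eig_def)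
    have "a * (R * x - 1) * (poly P (q * x) - poly P x) + (x - 1) * (poly P (x / q) - poly P x)
        = (\<Sum>i\<le>n. jacobi_coeff R ?s n i * T i)"
      unfolding P T_def by (simp add: sum_distrib_left sum.distrib sum_subtractf algebra_simps)
    also have "\<dots> = x * ((\<Sum>i\<le>n. jacobi_coeff R ?s n i * jacobi_eig ?s i * qpoch_nat (R * x) q i)
        - (\<Sum>i\<le>n. jacobi_coeff R ?s n i * B i))"
      unfolding T by (simp add: sum_distrib_left sum_subtractf algebra_simps)
    also have "(\<Sum>i\<le>n. jacobi_coeff R ?s n i * B i)
        = (\<Sum>i<n. (jacobi_eig ?s i - jacobi_eig ?s n) * jacobi_coeff R ?s n i * qpoch_nat (R * x) q i)"
    proof -
      have "(\<Sum>i\<le>n. jacobi_coeff R ?s n i * B i) = (\<Sum>i<n. jacobi_coeff R ?s n (Suc i) * B (Suc i))"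
        by (cases n) (simp_all add: sum.atMost_Suc_shift lessThan_Suc_atMost B_def del: sum.atMost_Suc)
      also have "\<dots> = (\<Sum>i<n. (jacobi_eig ?s i - jacobi_eig ?s n) * jacobi_coeff R ?s n i * qpoch_nat (R * x) q i)"
        unfolding jacobi_coeff_Suc [OF R, symmetric] by (simp add: B_def ac_simps)
      finally show ?thesis .
    qed
    also have "\<dots> = (\<Sum>i\<le>n. (jacobi_eig ?s i - jacobi_eig ?s n) * jacobi_coeff R ?s n i * qpoch_nat (R * x) q i)"
      by (simp add: lessThan_Suc_atMost [symmetric])
    finally show ?thesis
      unfolding P by (simp add: sum_distrib_left sum_subtractf algebra_simps)
  qed
  then have "[:- a, ?s:] * (pcompose P [:0, q:] - P) + [:-1, 1:] * (pcompose P [:0, 1 / q:] - P)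
      = pCons 0 (smult (jacobi_eig ?s n) P)"
    by (simp add: poly_eq_poly_eq_iff [symmetric] fun_eq_iff poly_pcompose algebra_simps)
  then have "coeff ([:- a, ?s:] * (pcompose P [:0, q:] - P) + [:-1, 1:] * (pcompose P [:0, 1 / q:] - P)) (Suc k)
      = coeff (pCons 0 (smult (jacobi_eig ?s n) P)) (Suc k)" for k by simp
  then have "?s * (q ^ k * coeff P k - coeff P k) - a * (q ^ Suc k * coeff P (Suc k) - coeff P (Suc k))
      + ((1 / q) ^ k * coeff P k - coeff P k) - ((1 / q) ^ Suc k * coeff P (Suc k) - coeff P (Suc k))
      = jacobi_eig ?s n * coeff P k" for k
    by (simp add: coeff_pcompose_linear mult_pCons_left del: power_Suc) (simp add: algebra_simps del: power_Suc)
  then have rec: "(1 / q ^ Suc k - 1) * (1 - a * q * q ^ k) * coeff P (Suc k) = (jacobi_eig ?s k - jacobi_eig ?s n) * coeff P k" for k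
  proof -
    assume *: "\<And>k. ?s * (q ^ k * coeff P k - coeff P k) - a * (q ^ Suc k * coeff P (Suc k) - coeff P (Suc k))
      + ((1 / q) ^ k * coeff P k - coeff P k) - ((1 / q) ^ Suc k * coeff P (Suc k) - coeff P (Suc k))
      = jacobi_eig ?s n * coeff P k"
    define y where "y = q ^ k"
    have "y > 0" using q0 by (simp add: y_def)
    then show ?thesis
      using * [of k] q0 unfolding jacobi_eig_def [of _ k] power_Suc power_one_over y_def [symmetric]
      by (simp add: field_simps)
  qed
  \<comment> \<open>Both coefficient sequences satisfy \<open>rec\<close>, whose leading factor never vanishes.\<close>
  have coeff_P: "coeff P k = coeff P 0 * jacobi_coeff (a * q) ?s n k" for k
  proof (induction k)
    case (Suc k)
    have "1 / q ^ Suc k - 1 > 0" using q0 q1 qpoch_factor_pos [OF q1, of k] by (simp add: field_simps)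
    moreover have "1 - a * q * q ^ k > 0" using qpoch_factor_pos [OF aq, of k] by simp
    moreover have "(1 / q ^ Suc k - 1) * (1 - a * q * q ^ k) * coeff P (Suc k)
        = (1 / q ^ Suc k - 1) * (1 - a * q * q ^ k) * (coeff P 0 * jacobi_coeff (a * q) ?s n (Suc k))"
      unfolding rec Suc using jacobi_coeff_Suc [OF aq, of k ?s n] by (simp add: ac_simps)
    ultimately show ?case by (simp only: mult_cancel_left) auto
  qed simp
  have deg: "degree (E i) \<le> i" for i
  proof -
    have "degree (E i) \<le> (\<Sum>j<i. degree [:1, - R * q ^ j:])"
      using degree_prod_sum_le [OF finite_lessThan, of "\<lambda>j. [:1, - R * q ^ j:]" i] unfolding E_def o_def .
    also have "\<dots> \<le> of_nat (card {..<i}) * 1" by (rule sum_bounded_above) simp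
    finally show ?thesis by simp
  qed
  have lead: "coeff (E i) i = (\<Prod>j<i. - R * q ^ j)" for i
  proof (induction i)
    case (Suc i)
    have "coeff (E i) (Suc i) = 0" using deg [of i] by (simp add: coeff_eq_0)
    then show ?case using Suc by (simp add: E_def mult.commute [of _ "[:1, _:]"])
  qed (simp add: E_def)
  have "coeff P n = (\<Sum>i\<le>n. if i = n then jacobi_coeff R ?s n n * (\<Prod>j<n. - R * q ^ j) else 0)"
    unfolding P_def coeff_sum
  proof (intro sum.cong refl)
    fix i assume "i \<in> {..n}"
    then show "coeff (smult (jacobi_coeff R ?s n i) (E i)) n
        = (if i = n then jacobi_coeff R ?s n n * (\<Prod>j<n. - R * q ^ j) else 0)"
      using deg [of i] by (auto simp: lead coeff_eq_0)
  qed
  then have top: "coeff P n = jacobi_coeff R ?s n n * (\<Prod>j<n. - R * q ^ j)" by simp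
  have "degree P \<le> n"
    unfolding P_def by (intro degree_sum_le) (use deg in \<open>auto intro: order_trans [OF degree_smult_le] order_trans\<close>)
  then have "poly P x = (\<Sum>k\<le>n. coeff P k * x ^ k)"
    unfolding poly_altdef by (intro sum.mono_neutral_left) (auto simp: coeff_eq_0)
  also have "\<dots> = coeff P 0 * (\<Sum>k\<le>n. jacobi_coeff (a * q) ?s n k * x ^ k)"
    by (subst coeff_P) (simp add: sum_distrib_left mult.assoc)
  also have "coeff P 0 = qpoch_nat (a * q) q n / qpoch_nat R q n * (\<Prod>j<n. - R * q ^ j)"
  proof -
    have nz: "jacobi_coeff (a * q) ?s n n \<noteq> 0" by (rule jacobi_coeff_top_nonzero [OF aq s])
    then have "coeff P 0 = jacobi_coeff R ?s n n / jacobi_coeff (a * q) ?s n n * (\<Prod>j<n. - R * q ^ j)"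
      using coeff_P [of n] top by (simp add: field_simps)
    also have "jacobi_coeff R ?s n n / jacobi_coeff (a * q) ?s n n = qpoch_nat (a * q) q n / qpoch_nat R q n"
    proof -
      define u where "u = qpoch_nat (1 / q ^ n) q n * qpoch_nat (?s * q ^ n) q n * q ^ n / qpoch_nat q q n"
      have "jacobi_coeff p ?s n n = u / qpoch_nat p q n" for p by (simp add: jacobi_coeff_def u_def)
      then show ?thesis using nz by auto
    qed
    finally show ?thesis .
  qed
  finally show ?thesis by (simp only: P)
qed

section \<open>The operators on combinations of powers and of factorials\<close>

lemma caputo_polynomial:
  assumes \<mu>: "0 < \<mu>" "\<mu> < 1"
    and f: "\<And>m. f (q ^ m) = of_real (\<Sum>k\<le>n. c k * (q powr (\<mu> + real k)) ^ m)"
  shows "left_int_exists q (1 - \<mu>) (q_deriv q f) (q ^ m)"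
    and "caputo q \<mu> f (q ^ m)
      = of_real (\<Sum>k\<le>n. c k * (q_Gamma q (\<mu> + real k + 1) / q_Gamma q (real k + 1)) * (q ^ m) ^ k)"
proof -
  let ?G = "q_Gamma q (1 - \<mu>)"
  define h where "h k = q_Gamma q (\<mu> + real k + 1) / q_Gamma q (real k + 1)" for k :: nat
  have G: "?G > 0" using \<mu> by (simp add: q_Gamma_pos)
  have "(\<lambda>i. \<Sum>k\<le>n. c k * (frac_kernel \<mu> i * ((q powr (\<mu> + real k)) ^ (m + i) - (q powr (\<mu> + real k)) ^ Suc (m + i))))
      sums (\<Sum>k\<le>n. c k * (?G * h k * (q powr (\<mu> + real k)) ^ m))"
    unfolding h_def by (intro sums_sum sums_mult caputo_power_sums \<mu>)
  then have "(\<lambda>i. complex_of_real (\<Sum>k\<le>n. c k * (frac_kernel \<mu> i * ((q powr (\<mu> + real k)) ^ (m + i) - (q powr (\<mu> + real k)) ^ Suc (m + i)))))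
      sums of_real (\<Sum>k\<le>n. c k * (?G * h k * (q powr (\<mu> + real k)) ^ m))"
    by (rule sums_of_real)
  moreover have "complex_of_real (\<Sum>k\<le>n. c k * (frac_kernel \<mu> i * ((q powr (\<mu> + real k)) ^ (m + i) - (q powr (\<mu> + real k)) ^ Suc (m + i))))
      = frac_kernel \<mu> i *\<^sub>R (f (q ^ (m + i)) - f (q ^ Suc (m + i)))" for i
    unfolding f scaleR_conv_of_real of_real_mult [symmetric] of_real_diff [symmetric] sum_subtractf [symmetric]
      sum_distrib_left
    by (intro arg_cong [of _ _ of_real] sum.cong refl) (simp add: algebra_simps)
  ultimately have *: "(\<lambda>i. frac_kernel \<mu> i *\<^sub>R (f (q ^ (m + i)) - f (q ^ Suc (m + i))))
      sums of_real (\<Sum>k\<le>n. c k * (?G * h k * (q powr (\<mu> + real k)) ^ m))"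
    by simp
  show "left_int_exists q (1 - \<mu>) (q_deriv q f) (q ^ m)"
    by (rule caputo_lattice(1) [OF *])
  have pw: "(q powr - \<mu>) ^ m * (q powr (\<mu> + real k)) ^ m = (q ^ m) ^ k" for k
    using q0 by (simp add: powr_realpow flip: power_mult_distrib powr_add power_mult)
      (simp add: mult.commute)
  show "caputo q \<mu> f (q ^ m) = of_real (\<Sum>k\<le>n. c k * (q_Gamma q (\<mu> + real k + 1) / q_Gamma q (real k + 1)) * (q ^ m) ^ k)"
    unfolding caputo_lattice(2) [OF *] h_def [symmetric] pw [symmetric] scaleR_conv_of_real of_real_mult [symmetric]
      sum_distrib_left
    using G by (intro arg_cong [of _ _ of_real] sum.cong refl) simp
qed

text \<open>On sums of factorials the right-sided integral is explicit and continuous at \<open>0\<close>, and the right-sided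
  derivative lowers each index by \<open>\<mu>\<close>.\<close>

lemma right_operators_qpoch_sum:
  assumes \<mu>: "0 < \<mu>" "\<mu> < 1" and \<beta>: "\<beta> > -1"
    and f: "\<And>m. f (q ^ m) = of_real (\<Sum>i\<le>n. d i * qpoch (q * q ^ m) q (\<beta> + \<mu> + real i))"
  shows "right_int_exists q (1 - \<mu>) f 0"
    and "(\<lambda>k. right_int q (1 - \<mu>) f (q ^ k)) \<longlonglongrightarrow> right_int q (1 - \<mu>) f 0"
    and "right_RL q \<mu> f (q ^ k) = of_real (\<Sum>i\<le>n. d i
      * (q_Gamma q (\<beta> + \<mu> + real i + 1) / q_Gamma q (\<beta> + real i + 1)) * qpoch (q * q ^ k) q (\<beta> + real i))"
proof -
  let ?G = "q_Gamma q (1 - \<mu>)"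
  define Z where "Z = q powr (1 - \<mu>)"
  define b where "b i = \<beta> + \<mu> + real i" for i
  define \<rho> where "\<rho> i = q_Gamma q (b i + 1) / q_Gamma q (b i + 2 - \<mu>)" for i
  have b: "b i > -1" for i using \<mu> \<beta> by (simp add: b_def)
  have G: "?G > 0" using \<mu> by (simp add: q_Gamma_pos)
  have int: "right_int q (1 - \<mu>) f (q ^ k)
      = of_real (\<Sum>i\<le>n. d i * \<rho> i * qpoch (q * q ^ k) q (b i + 1 - \<mu>))" for k
  proof -
    have "(\<Sum>m\<le>k. (Z ^ m * frac_kernel \<mu> (k - m)) *\<^sub>R f (q ^ m))
        = of_real (\<Sum>m\<le>k. \<Sum>i\<le>n. d i * (Z ^ m * frac_kernel \<mu> (k - m) * qpoch (q * q ^ m) q (b i)))"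
      unfolding f b_def scaleR_conv_of_real of_real_mult [symmetric] of_real_sum [symmetric] sum_distrib_left
      by (intro arg_cong [of _ _ of_real] sum.cong refl) (simp add: ac_simps)
    also have "\<dots> = of_real (\<Sum>i\<le>n. d i * (?G / (1 - q) * \<rho> i * qpoch (q * q ^ k) q (b i + 1 - \<mu>)))"
      unfolding \<rho>_def right_int_qpoch_sum(1) [OF \<mu> b, symmetric] Z_def [symmetric]
      by (subst sum.swap) (simp only: sum_distrib_left)
    finally have sum: "(\<Sum>m\<le>k. (Z ^ m * frac_kernel \<mu> (k - m)) *\<^sub>R f (q ^ m))
        = of_real (\<Sum>i\<le>n. d i * (?G / (1 - q) * \<rho> i * qpoch (q * q ^ k) q (b i + 1 - \<mu>)))" .
    show ?thesis
      unfolding right_int_lattice(2) Z_def [symmetric] sum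
      unfolding scaleR_conv_of_real of_real_mult [symmetric] sum_distrib_left
      using G q1 by (intro arg_cong [of _ _ of_real] sum.cong refl) simp
  qed
  have "(\<lambda>m. \<Sum>i\<le>n. d i * (Z ^ m * qpoch (q * q ^ m) q (b i))) sums (\<Sum>i\<le>n. d i * (?G / (1 - q) * \<rho> i))"
    unfolding Z_def \<rho>_def by (intro sums_sum sums_mult right_int_qpoch_sum(2) \<mu> b)
  then have "(\<lambda>m. complex_of_real (\<Sum>i\<le>n. d i * (Z ^ m * qpoch (q * q ^ m) q (b i)))) sums of_real (\<Sum>i\<le>n. d i * (?G / (1 - q) * \<rho> i))"
    by (rule sums_of_real)
  moreover have "complex_of_real (\<Sum>i\<le>n. d i * (Z ^ m * qpoch (q * q ^ m) q (b i))) = Z ^ m *\<^sub>R f (q ^ m)" for m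
    unfolding f b_def scaleR_conv_of_real of_real_mult [symmetric] sum_distrib_left
    by (intro arg_cong [of _ _ of_real] sum.cong refl) (simp add: ac_simps)
  ultimately have "(\<lambda>m. Z ^ m *\<^sub>R f (q ^ m)) sums of_real (\<Sum>i\<le>n. d i * (?G / (1 - q) * \<rho> i))"
    by simp
  note origin = right_int_origin [OF this [unfolded Z_def]]
  show "right_int_exists q (1 - \<mu>) f 0" by (rule origin(1))
  have origin_val: "right_int q (1 - \<mu>) f 0 = of_real (\<Sum>i\<le>n. d i * \<rho> i * 1)"
    unfolding origin(2) scaleR_conv_of_real of_real_mult [symmetric] sum_distrib_left
    using G q1 by (intro arg_cong [of _ _ of_real] sum.cong refl) simp
  show "(\<lambda>k. right_int q (1 - \<mu>) f (q ^ k)) \<longlonglongrightarrow> right_int q (1 - \<mu>) f 0"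
    unfolding int origin_val
    by (intro tendsto_intros qpoch_lattice_tendsto_1) (use b \<mu> \<beta> in \<open>simp add: b_def\<close>)
  have int': "right_int q (1 - \<mu>) f (q ^ k / q)
      = of_real (\<Sum>i\<le>n. d i * \<rho> i * qpoch (q ^ k) q (b i + 1 - \<mu>))"
  proof (cases k)
    case 0
    have "qpoch 1 q v = 0" for v using qpoch_neg_power [of 0 v] by simp
    then show ?thesis using right_int_beyond(2) [of \<mu> f] 0 by simp
  next
    case (Suc j)
    then show ?thesis using int [of j] q0 by simp
  qed
  have step: "\<rho> i * (qpoch (q * q ^ k) q (b i + 1 - \<mu>) - qpoch (q ^ k) q (b i + 1 - \<mu>))
      = (1 - q) * q ^ k * ((q_Gamma q (\<beta> + \<mu> + real i + 1) / q_Gamma q (\<beta> + real i + 1)) * qpoch (q * q ^ k) q (\<beta> + real i))" for i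
  proof -
    define c where "c = \<beta> + real i"
    have c: "c > -1" using \<beta> by (simp add: c_def)
    have e: "b i + 1 - \<mu> = c + 1" "b i + 2 - \<mu> = c + 1 + real 1" by (simp_all add: b_def c_def)
    define u where "u = 1 - q powr (c + 1)"
    have "q powr (c + 1) < 1" by (rule q_powr_less_1) (use c in simp)
    then have u: "u \<noteq> 0" by (simp add: u_def)
    have Gc: "q_Gamma q (c + 1) > 0" by (rule q_Gamma_pos) (use c in simp)
    have "q_Gamma q (c + 1 + real 1) = q_Gamma q (c + 1) * (1 - q powr (c + 1)) / (1 - q)"
      using c by (subst q_Gamma_add_nat) (simp_all add: qpoch_nat_def)
    then have "\<rho> i = q_Gamma q (\<beta> + \<mu> + real i + 1) / (q_Gamma q (c + 1) * u / (1 - q))"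
      unfolding \<rho>_def e u_def by (simp add: b_def)
    then show ?thesis
      unfolding e qpoch_difference [OF c] c_def [symmetric] u_def [symmetric]
      using q1 u Gc by simp
  qed
  have "(\<Sum>i\<le>n. d i * \<rho> i * qpoch (q * q ^ k) q (b i + 1 - \<mu>)) - (\<Sum>i\<le>n. d i * \<rho> i * qpoch (q ^ k) q (b i + 1 - \<mu>))
      = (1 - q) * q ^ k * (\<Sum>i\<le>n. d i
      * (q_Gamma q (\<beta> + \<mu> + real i + 1) / q_Gamma q (\<beta> + real i + 1)) * qpoch (q * q ^ k) q (\<beta> + real i))"
    unfolding sum_subtractf [symmetric] sum_distrib_left
  proof (rule sum.cong [OF refl])
    fix i
    have "d i * \<rho> i * qpoch (q * q ^ k) q (b i + 1 - \<mu>) - d i * \<rho> i * qpoch (q ^ k) q (b i + 1 - \<mu>)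
        = d i * (\<rho> i * (qpoch (q * q ^ k) q (b i + 1 - \<mu>) - qpoch (q ^ k) q (b i + 1 - \<mu>)))"
      by (simp add: algebra_simps)
    then show "d i * \<rho> i * qpoch (q * q ^ k) q (b i + 1 - \<mu>) - d i * \<rho> i * qpoch (q ^ k) q (b i + 1 - \<mu>)
        = (1 - q) * q ^ k * (d i * (q_Gamma q (\<beta> + \<mu> + real i + 1) / q_Gamma q (\<beta> + real i + 1)) * qpoch (q * q ^ k) q (\<beta> + real i))"
      unfolding step by (simp add: ac_simps)
  qed
  note difference = this
  have cancel: "inverse ((1 - q) * q ^ k) * ((1 - q) * q ^ k * t) = t" for t :: real
    using q0 q1 by (subst mult.assoc [symmetric], subst left_inverse) auto
  show "right_RL q \<mu> f (q ^ k) = of_real (\<Sum>i\<le>n. d i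
      * (q_Gamma q (\<beta> + \<mu> + real i + 1) / q_Gamma q (\<beta> + real i + 1)) * qpoch (q * q ^ k) q (\<beta> + real i))"
    unfolding right_RL_lattice int int' of_real_diff [symmetric] difference
      scaleR_conv_of_real of_real_mult [symmetric] cancel ..
qed

end

section \<open>The eigenfunctions\<close>

locale sl_problem = q_base +
  fixes \<mu> \<beta> :: real
  assumes \<mu>0: "0 < \<mu>" and \<mu>1: "\<mu> < 1" and \<beta>: "-1 < \<beta>"
begin

text \<open>The product \<open>a b q\<close> for \<open>a = q\<^sup>\<mu>\<close>, \<open>b = q\<^sup>\<beta>\<close>. It has the same value for \<open>a = 1\<close>, \<open>b = q\<^sup>\<beta>\<^sup>+\<^sup>\<mu>\<close>, the parameters of
  the Caputo derivative; this is why the two families share their q-difference eigenvalues.\<close>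

abbreviation "abq \<equiv> q powr (\<mu> + \<beta> + 1)"

lemma abq_eq: "abq = q powr \<mu> * q powr (\<beta> + 1)"
  by (simp add: add.assoc flip: powr_add)

lemma params_less_1: "q powr \<mu> * q < 1" "q powr (\<beta> + 1) < 1" "abq < 1" "abq * q ^ n < 1"
proof -
  show "q powr (\<beta> + 1) < 1" "abq < 1" by (rule q_powr_less_1; use \<mu>0 \<beta> in simp)+
  then show "abq * q ^ n < 1" using qpoch_factor_pos [of abq n] by simp
  have "q powr \<mu> < 1" using \<mu>0 by (rule q_powr_less_1)
  then show "q powr \<mu> * q < 1" using qpoch_factor_pos [of "q powr \<mu>" 1] by simp
qed

lemma little_q_jacobi_eq:
  "little_q_jacobi q \<mu> \<beta> n x = (\<Sum>k\<le>n. jacobi_coeff (q powr \<mu> * q) abq n k * x ^ k)"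
proof -
  have "q powr (- real n) = 1 / q ^ n" "q powr (\<mu> + \<beta> + real n + 1) = abq * q ^ n" "q powr (\<mu> + 1) = q powr \<mu> * q"
    using q0 by (simp_all add: powr_minus_divide powr_realpow powr_add)
  then show ?thesis
    unfolding little_q_jacobi_def jacobi_coeff_def by (simp add: power_mult_distrib mult.assoc)
qed

lemma sl_phi_lattice:
  "sl_phi q \<mu> \<beta> n (q ^ m) = of_real ((q powr \<mu>) ^ m * little_q_jacobi q \<mu> \<beta> n (q ^ m))"
  by (simp add: sl_phi_def q_power_powr)

lemma q_Gamma_shift:
  "q_Gamma q (\<mu> + real k + 1) = q_Gamma q (\<mu> + 1) * qpoch_nat (q powr \<mu> * q) q k / (1 - q) ^ k"
  "q_Gamma q (real k + 1) = qpoch_nat q q k / (1 - q) ^ k"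
  "q_Gamma q (\<beta> + \<mu> + real k + 1) = q_Gamma q (\<beta> + \<mu> + 1) * qpoch_nat abq q k / (1 - q) ^ k"
  "q_Gamma q (\<beta> + real k + 1) = q_Gamma q (\<beta> + 1) * qpoch_nat (q powr (\<beta> + 1)) q k / (1 - q) ^ k"
  using q_Gamma_add_nat [of "\<mu> + 1" k] q_Gamma_add_nat [of 1 k] q_Gamma_add_nat [of "\<beta> + \<mu> + 1" k]
    q_Gamma_add_nat [of "\<beta> + 1" k] q0 \<mu>0 \<beta>
  by (simp_all add: ac_simps powr_add)

text \<open>The Gamma quotients of the power rule replace the denominator \<open>(q\<^sup>\<mu>\<^sup>+\<^sup>1; q)\<^sub>k\<close> by \<open>(q; q)\<^sub>k\<close>: the result is a multiple of
  \<open>p\<^sub>n(x; 1, q\<^sup>\<beta>\<^sup>+\<^sup>\<mu>)\<close>.\<close>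

lemma caputo_phi:
  shows "left_int_exists q (1 - \<mu>) (q_deriv q (sl_phi q \<mu> \<beta> n)) (q ^ m)"
    and "caputo q \<mu> (sl_phi q \<mu> \<beta> n) (q ^ m)
      = of_real (q_Gamma q (\<mu> + 1) * (\<Sum>k\<le>n. jacobi_coeff q abq n k * (q ^ m) ^ k))"
proof -
  define c where "c = jacobi_coeff (q powr \<mu> * q) abq n"
  have "(q powr \<mu>) ^ m * (q ^ m) ^ k = (q powr (\<mu> + real k)) ^ m" for m k
    using q0 by (simp add: powr_add powr_realpow power_mult_distrib mult.commute flip: power_mult)
  then have phi: "sl_phi q \<mu> \<beta> n (q ^ m) = of_real (\<Sum>k\<le>n. c k * (q powr (\<mu> + real k)) ^ m)" for m
    unfolding sl_phi_lattice little_q_jacobi_eq c_def sum_distrib_left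
    by (simp only: mult.left_commute [of "(q powr \<mu>) ^ m"])
  show "left_int_exists q (1 - \<mu>) (q_deriv q (sl_phi q \<mu> \<beta> n)) (q ^ m)"
    by (rule caputo_polynomial(1) [OF \<mu>0 \<mu>1 phi])
  have "c k * (q_Gamma q (\<mu> + real k + 1) / q_Gamma q (real k + 1)) = q_Gamma q (\<mu> + 1) * jacobi_coeff q abq n k" for k
    unfolding c_def q_Gamma_shift jacobi_coeff_def
    using q1 qpoch_nat_pos [OF params_less_1(1), of k] by simp
  then show "caputo q \<mu> (sl_phi q \<mu> \<beta> n) (q ^ m)
      = of_real (q_Gamma q (\<mu> + 1) * (\<Sum>k\<le>n. jacobi_coeff q abq n k * (q ^ m) ^ k))"
    unfolding caputo_polynomial(2) [OF \<mu>0 \<mu>1 phi] by (simp add: sum_distrib_left mult.assoc)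
qed

text \<open>The change of basis for \<open>a = 1\<close>, \<open>b = q\<^sup>\<beta>\<^sup>+\<^sup>\<mu>\<close> prepares the flux for the right-sided derivative: the weight and
  the basis elements combine to single factorials.\<close>

lemma flux_phi:
  "sl_flux q \<mu> \<beta> (sl_phi q \<mu> \<beta> n) (q ^ m) = of_real (\<Sum>i\<le>n.
     q_Gamma q (\<mu> + 1) / (qpoch_nat q q n / qpoch_nat abq q n * (\<Prod>j<n. - abq * q ^ j)) * jacobi_coeff abq abq n i
     * qpoch (q * q ^ m) q (\<beta> + \<mu> + real i))"
proof -
  define K where "K = qpoch_nat q q n / qpoch_nat abq q n * (\<Prod>j<n. - abq * q ^ j)"
  have K: "K \<noteq> 0"
    unfolding K_def using qpoch_nat_pos [OF params_less_1(3), of n] qpoch_nat_pos [OF q1, of n] q0 by simp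
  have "(\<Sum>k\<le>n. jacobi_coeff q abq n k * (q ^ m) ^ k) = 1 / K * (\<Sum>i\<le>n. jacobi_coeff abq abq n i * qpoch_nat (abq * q ^ m) q i)"
    using jacobi_change_of_basis [of 1 abq n "q ^ m"] params_less_1 q1 K by (simp add: K_def)
  moreover have "qpoch (q * q ^ m) q (\<beta> + \<mu> + real i)
      = qpoch (q * q ^ m) q (\<beta> + \<mu>) * qpoch_nat (abq * q ^ m) q i" for i
  proof -
    have "q powr (\<beta> + \<mu>) * q * q ^ m = abq * q ^ m" using q0 by (simp add: powr_add ac_simps)
    then show ?thesis
      using qpoch_add_nat [of "\<beta> + \<mu>" "q ^ m" i] \<beta> \<mu>0 q0 q1 by (simp add: power_le_one)
  qed
  ultimately show ?thesis
    unfolding sl_flux_def caputo_phi(2) scaleR_conv_of_real of_real_mult [symmetric] K_def [symmetric]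
    by (simp add: sum_distrib_left ac_simps)
qed

lemma sl_eigenvalue_eq:
  "sl_eigenvalue q \<mu> \<beta> n = q_Gamma q (\<mu> + 1) * q_Gamma q (\<beta> + \<mu> + 1) / q_Gamma q (\<beta> + 1)
     * ((q powr - \<mu>) ^ n * (qpoch_nat abq q n * qpoch_nat (q powr \<mu> * q) q n)
       / (qpoch_nat (q powr (\<beta> + 1)) q n * qpoch_nat q q n))"
proof -
  have e: "\<mu> + \<beta> + real n + 1 = \<beta> + \<mu> + real n + 1" "\<beta> + 1 + real n = \<beta> + real n + 1" by simp_all
  have "q powr (- real n * \<mu>) = (q powr - \<mu>) ^ n"
    using q0 by (simp add: powr_powr mult.commute flip: powr_realpow)
  then show ?thesis
    unfolding sl_eigenvalue_def e q_Gamma_shift using q1 by (simp add: field_simps)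
qed

lemma sl_rhs_lattice:
  "sl_rhs q \<mu> \<beta> y (q ^ k) = ((q powr - \<mu>) ^ k * qpoch (q * q ^ k) q \<beta>) *\<^sub>R y (q ^ k)"
  by (simp add: sl_rhs_def q_power_powr)

lemma sl_rhs_phi:
  "sl_rhs q \<mu> \<beta> (sl_phi q \<mu> \<beta> n) (q ^ k) = of_real (qpoch (q * q ^ k) q \<beta> * little_q_jacobi q \<mu> \<beta> n (q ^ k))"
proof -
  have "(q powr - \<mu>) ^ k * (q powr \<mu>) ^ k = 1"
    using q0 by (simp flip: power_mult_distrib powr_add)
  then show ?thesis
    unfolding sl_rhs_lattice sl_phi_lattice scaleR_conv_of_real of_real_mult [symmetric]
    by (simp add: mult.assoc mult.left_commute [of _ "qpoch _ _ _"] flip: mult.assoc [of _ "(q powr \<mu>) ^ k"])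
qed

text \<open>The right-sided derivative replaces the denominators \<open>(q\<^sup>\<beta>\<^sup>+\<^sup>\<mu>\<^sup>+\<^sup>1; q)\<^sub>i\<close> by \<open>(q\<^sup>\<beta>\<^sup>+\<^sup>1; q)\<^sub>i\<close>, so the change of basis for
  \<open>a = q\<^sup>\<mu>\<close>, \<open>b = q\<^sup>\<beta>\<close>, read backwards, returns the original polynomial. The eigenvalue is the quotient of the two
  basis-change factors \<open>K\<close> and \<open>K'\<close> times the Gamma values.\<close>

lemma right_RL_flux_phi:
  "right_RL q \<mu> (sl_flux q \<mu> \<beta> (sl_phi q \<mu> \<beta> n)) (q ^ k)
    = of_real (sl_eigenvalue q \<mu> \<beta> n) * sl_rhs q \<mu> \<beta> (sl_phi q \<mu> \<beta> n) (q ^ k)"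
proof -
  let ?R = "q powr (\<beta> + 1)"
  define K where "K = qpoch_nat q q n / qpoch_nat abq q n * (\<Prod>j<n. - abq * q ^ j)"
  define K' where "K' = qpoch_nat (q powr \<mu> * q) q n / qpoch_nat ?R q n * (\<Prod>j<n. - ?R * q ^ j)"
  define D where "D = q_Gamma q (\<mu> + 1) * q_Gamma q (\<beta> + \<mu> + 1) / q_Gamma q (\<beta> + 1)"
  let ?w = "qpoch (q * q ^ k) q \<beta>"
  have pos: "qpoch_nat abq q i > 0" "qpoch_nat ?R q i > 0" "qpoch_nat q q i > 0" "qpoch_nat (q powr \<mu> * q) q i > 0" for i
    using params_less_1 q1 by (simp_all add: qpoch_nat_pos)
  have G: "q_Gamma q (\<beta> + 1) > 0" using \<beta> by (simp add: q_Gamma_pos)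
  have summand: "q_Gamma q (\<mu> + 1) / K * jacobi_coeff abq abq n i
      * (q_Gamma q (\<beta> + \<mu> + real i + 1) / q_Gamma q (\<beta> + real i + 1)) * qpoch (q * q ^ k) q (\<beta> + real i)
      = D / K * ?w * (jacobi_coeff ?R abq n i * qpoch_nat (?R * q ^ k) q i)" for i
  proof -
    have "q powr \<beta> * q * q ^ k = ?R * q ^ k" using q0 by (simp add: powr_add)
    then have "qpoch (q * q ^ k) q (\<beta> + real i) = ?w * qpoch_nat (?R * q ^ k) q i"
      using qpoch_add_nat [of \<beta> "q ^ k" i] \<beta> q0 q1 by (simp add: power_le_one)
    moreover have "jacobi_coeff abq abq n i * (q_Gamma q (\<beta> + \<mu> + real i + 1) / q_Gamma q (\<beta> + real i + 1))
        = q_Gamma q (\<beta> + \<mu> + 1) / q_Gamma q (\<beta> + 1) * jacobi_coeff ?R abq n i"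
      unfolding q_Gamma_shift jacobi_coeff_def using pos [of i] q1 by (simp add: ac_simps)
    ultimately have "q_Gamma q (\<mu> + 1) / K * (jacobi_coeff abq abq n i
        * (q_Gamma q (\<beta> + \<mu> + real i + 1) / q_Gamma q (\<beta> + real i + 1))) * qpoch (q * q ^ k) q (\<beta> + real i)
        = q_Gamma q (\<mu> + 1) / K * (q_Gamma q (\<beta> + \<mu> + 1) / q_Gamma q (\<beta> + 1) * jacobi_coeff ?R abq n i)
          * (?w * qpoch_nat (?R * q ^ k) q i)"
      by (simp only:)
    then show ?thesis by (simp add: D_def ac_simps)
  qed
  have "right_RL q \<mu> (sl_flux q \<mu> \<beta> (sl_phi q \<mu> \<beta> n)) (q ^ k)
      = of_real (D / K * ?w * (\<Sum>i\<le>n. jacobi_coeff ?R abq n i * qpoch_nat (?R * q ^ k) q i))"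
    unfolding right_operators_qpoch_sum(3) [OF \<mu>0 \<mu>1 \<beta> flux_phi] K_def [symmetric] summand sum_distrib_left ..
  also have "(\<Sum>i\<le>n. jacobi_coeff ?R abq n i * qpoch_nat (?R * q ^ k) q i) = K' * little_q_jacobi q \<mu> \<beta> n (q ^ k)"
    unfolding little_q_jacobi_eq K'_def
    using jacobi_change_of_basis [of "q powr \<mu>" ?R n "q ^ k"] params_less_1 by (simp add: abq_eq)
  also have "D / K * ?w * (K' * little_q_jacobi q \<mu> \<beta> n (q ^ k))
      = sl_eigenvalue q \<mu> \<beta> n * (?w * little_q_jacobi q \<mu> \<beta> n (q ^ k))"
  proof -
    have "(\<Prod>j<n. - ?R * q ^ j) = (q powr - \<mu>) ^ n * (\<Prod>j<n. - abq * q ^ j)"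
    proof -
      have "q powr - \<mu> * abq = ?R" by (simp add: add.commute flip: powr_add)
      then have "- ?R * q ^ j = q powr - \<mu> * (- abq * q ^ j)" for j
        by (metis minus_mult_commute mult.assoc mult_minus_left)
      then have "(\<Prod>j<n. - ?R * q ^ j) = (\<Prod>j<n. q powr - \<mu> * (- abq * q ^ j))" by (rule prod.cong [OF refl])
      then show ?thesis unfolding prod.distrib by simp
    qed
    moreover have "(\<Prod>j<n. - abq * q ^ j) \<noteq> 0" using q0 by simp
    ultimately have eig: "D * K' / K = sl_eigenvalue q \<mu> \<beta> n"
      unfolding sl_eigenvalue_eq D_def [symmetric] K_def K'_def using pos [of n] by (simp add: field_simps)
    have "D / K * ?w * (K' * little_q_jacobi q \<mu> \<beta> n (q ^ k)) = (D * K' / K) * (?w * little_q_jacobi q \<mu> \<beta> n (q ^ k))"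
      by simp
    then show ?thesis unfolding eig .
  qed
  finally show ?thesis unfolding sl_rhs_phi by simp
qed

lemma sl_rhs_phi_tendsto: "(\<lambda>k. sl_rhs q \<mu> \<beta> (sl_phi q \<mu> \<beta> n) (q ^ k)) \<longlonglongrightarrow> 1"
proof -
  have "(\<lambda>k. sl_rhs q \<mu> \<beta> (sl_phi q \<mu> \<beta> n) (q ^ k))
      \<longlonglongrightarrow> of_real (1 * (\<Sum>j\<le>n. jacobi_coeff (q powr \<mu> * q) abq n j * 0 ^ j))"
    unfolding sl_rhs_phi little_q_jacobi_eq using q0 q1 \<beta>
    by (intro tendsto_intros qpoch_lattice_tendsto_1 LIMSEQ_realpow_zero) auto
  moreover have "(\<Sum>j\<le>n. jacobi_coeff (q powr \<mu> * q) abq n j * 0 ^ j) = 1"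
    by (simp add: sum.atMost_shift)
  ultimately show ?thesis by simp
qed

text \<open>At the origin, the equation is the limit of the equation at the lattice points.\<close>

theorem sl_phi_solution:
  "sl_solution q \<mu> \<beta> (of_real (sl_eigenvalue q \<mu> \<beta> n)) (sl_phi q \<mu> \<beta> n)"
proof -
  let ?\<phi> = "sl_phi q \<mu> \<beta> n" and ?\<Lambda> = "complex_of_real (sl_eigenvalue q \<mu> \<beta> n)"
  let ?f = "sl_flux q \<mu> \<beta> ?\<phi>"
  let ?g = "right_int q (1 - \<mu>) ?f"
  have "sl_well_defined q \<mu> \<beta> ?\<phi>"
    unfolding sl_well_defined_def q_lattice_def
    using caputo_phi(1) right_int_lattice(1) right_int_beyond(1)
      right_operators_qpoch_sum(1) [OF \<mu>0 \<mu>1 \<beta> flux_phi] by auto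
  moreover have "sl_equation q \<mu> \<beta> ?\<Lambda> ?\<phi>"
  proof -
    have "(?g (q ^ Suc k) - ?g (q ^ k)) /\<^sub>R ((1 - q) * q ^ Suc k) = ?\<Lambda> * sl_rhs q \<mu> \<beta> ?\<phi> (q ^ Suc k)" for k
      using right_RL_lattice [of \<mu> ?f "Suc k"] right_RL_flux_phi [of n "Suc k"] q0 by simp
    moreover have "(\<lambda>k. ?\<Lambda> * sl_rhs q \<mu> \<beta> ?\<phi> (q ^ Suc k)) \<longlonglongrightarrow> ?\<Lambda> * 1"
      by (intro tendsto_intros LIMSEQ_Suc [OF sl_rhs_phi_tendsto])
    ultimately have "has_q_deriv_at_0 q ?g (- q *\<^sub>R (?\<Lambda> * 1))"
      by (intro q_deriv_at_0_from_lattice right_operators_qpoch_sum(2) [OF \<mu>0 \<mu>1 \<beta> flux_phi]) simp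
    then have "has_right_RL_at_0 q \<mu> ?f (?\<Lambda> * 1)"
      unfolding has_right_RL_at_0_def using q0 by (intro exI [of _ "- q *\<^sub>R (?\<Lambda> * 1)"]) simp
    then show ?thesis
      unfolding sl_equation_def using right_RL_flux_phi sl_rhs_phi_tendsto by blast
  qed
  moreover have "?\<phi> 0 = 0" by (simp add: sl_phi_def)
  ultimately show ?thesis
    unfolding sl_solution_def by (simp add: right_int_beyond(2))
qed

theorem sl_phi_eigenfunction:
  "sl_eigenfunction q \<mu> \<beta> (of_real (sl_eigenvalue q \<mu> \<beta> n)) (sl_phi q \<mu> \<beta> n)"
proof -
  have "\<exists>k. sl_phi q \<mu> \<beta> n (q ^ k) \<noteq> 0"
  proof (rule ccontr)
    assume "\<nexists>k. sl_phi q \<mu> \<beta> n (q ^ k) \<noteq> 0"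
    then have "(\<lambda>k. 0) \<longlonglongrightarrow> (1 :: complex)"
      using sl_rhs_phi_tendsto [of n] by (simp add: sl_rhs_def)
    then show False by (simp add: LIMSEQ_const_iff)
  qed
  then show ?thesis
    using sl_phi_solution unfolding sl_eigenfunction_def q_lattice_def by blast
qed

section \<open>Uniqueness\<close>

text \<open>The equation at the origin requires \<open>x\<^sup>-\<^sup>\<mu> y(x)\<close> to converge, so \<open>y = O(x\<^sup>\<mu>)\<close>. This makes
  \<open>fractional_integration_by_parts\<close> applicable to any pair of solutions.\<close>

lemma sl_solution_bounds:
  assumes "sl_solution q \<mu> \<beta> \<Lambda> y"
  shows "\<exists>C. \<forall>n. norm (y (q ^ n)) \<le> C * (q powr \<mu>) ^ n"
    and "\<exists>B. \<forall>n. norm (sl_flux q \<mu> \<beta> y (q ^ n)) \<le> B"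
proof -
  let ?w = "\<lambda>n. qpoch (q * q ^ n) q \<beta>"
  obtain r where "(\<lambda>k. sl_rhs q \<mu> \<beta> y (q ^ k)) \<longlonglongrightarrow> r"
    using assms unfolding sl_solution_def sl_equation_def by blast
  then have "(\<lambda>k. inverse (?w k) *\<^sub>R sl_rhs q \<mu> \<beta> y (q ^ k)) \<longlonglongrightarrow> inverse 1 *\<^sub>R r"
    by (intro tendsto_intros qpoch_lattice_tendsto_1 \<beta>) simp
  then have "Bseq (\<lambda>k. inverse (?w k) *\<^sub>R sl_rhs q \<mu> \<beta> y (q ^ k))"
    by (rule convergent_imp_Bseq [OF convergentI])
  then obtain C where C: "\<And>n. norm (inverse (?w n) *\<^sub>R sl_rhs q \<mu> \<beta> y (q ^ n)) \<le> C"
    unfolding Bseq_def by blast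
  have "norm (y (q ^ n)) \<le> C * (q powr \<mu>) ^ n" for n
  proof -
    have "(q powr \<mu>) ^ n * (inverse (?w n) * ((q powr - \<mu>) ^ n * ?w n)) = 1"
    proof -
      have "(q powr \<mu>) ^ n * (q powr - \<mu>) ^ n = 1" using q0 by (simp flip: power_mult_distrib powr_add)
      moreover have "inverse (?w n) * ((q powr - \<mu>) ^ n * ?w n) = (q powr - \<mu>) ^ n"
        using qpoch_lattice_pos [OF \<beta>, of n] by simp
      ultimately show ?thesis by (simp only:)
    qed
    then have "y (q ^ n) = (q powr \<mu>) ^ n *\<^sub>R (inverse (?w n) *\<^sub>R sl_rhs q \<mu> \<beta> y (q ^ n))"
      unfolding sl_rhs_lattice scaleR_scaleR by simp
    then have "norm (y (q ^ n)) = (q powr \<mu>) ^ n * norm (inverse (?w n) *\<^sub>R sl_rhs q \<mu> \<beta> y (q ^ n))"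
      by (metis abs_of_nonneg norm_scaleR powr_ge_zero zero_le_power)
    also have "\<dots> \<le> (q powr \<mu>) ^ n * C" by (intro mult_left_mono C) simp
    finally show ?thesis by (simp add: mult.commute)
  qed
  then show "\<exists>C. \<forall>n. norm (y (q ^ n)) \<le> C * (q powr \<mu>) ^ n" by blast
  then obtain C where C: "\<And>n. norm (y (q ^ n)) \<le> C * (q powr \<mu>) ^ n" by blast
  obtain B where B: "\<And>n. norm (caputo q \<mu> y (q ^ n)) \<le> B"
    using caputo_of_power_bound(2) [OF \<mu>0 \<mu>1 C] by blast
  obtain A where A: "\<And>n. \<bar>qpoch (q * q ^ n) q (\<beta> + \<mu>)\<bar> \<le> A"
    using qpoch_lattice_bounded [of "\<beta> + \<mu>"] \<beta> \<mu>0 by force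
  have "norm (sl_flux q \<mu> \<beta> y (q ^ n)) \<le> A * B" for n
    unfolding sl_flux_def norm_scaleR using A [of n] by (intro mult_mono A B) auto
  then show "\<exists>B. \<forall>n. norm (sl_flux q \<mu> \<beta> y (q ^ n)) \<le> B" by blast
qed

text \<open>After integration by parts, the flux of one solution is paired with the Caputo derivative of the other,
  which is symmetric in the two.\<close>

lemma sl_solutions_orthogonal:
  assumes y: "sl_solution q \<mu> \<beta> \<Lambda> y" and z: "sl_solution q \<mu> \<beta> \<Lambda>' z" and ne: "\<Lambda> \<noteq> \<Lambda>'"
  shows "(\<lambda>k. q ^ k *\<^sub>R (sl_rhs q \<mu> \<beta> y (q ^ k) * z (q ^ k))) sums 0"
proof -
  have parts: "\<exists>s. (\<lambda>k. q ^ k *\<^sub>R (\<Lambda>1 * sl_rhs q \<mu> \<beta> u (q ^ k) * v (q ^ k))) sums s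
      \<and> (\<lambda>k. q ^ k *\<^sub>R (sl_flux q \<mu> \<beta> u (q ^ k) * caputo q \<mu> v (q ^ k))) sums s"
    if u: "sl_solution q \<mu> \<beta> \<Lambda>1 u" and v: "sl_solution q \<mu> \<beta> \<Lambda>2 v" for \<Lambda>1 \<Lambda>2 u v
  proof -
    obtain B where B: "\<And>n. norm (sl_flux q \<mu> \<beta> u (q ^ n)) \<le> B"
      using sl_solution_bounds(2) [OF u] by blast
    obtain C where C: "\<And>n. norm (v (q ^ n)) \<le> C * (q powr \<mu>) ^ n"
      using sl_solution_bounds(1) [OF v] by blast
    have "right_RL q \<mu> (sl_flux q \<mu> \<beta> u) (q ^ k) = \<Lambda>1 * sl_rhs q \<mu> \<beta> u (q ^ k)" for k
      using u unfolding sl_solution_def sl_equation_def by blast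
    then show ?thesis
      using fractional_integration_by_parts [of \<mu> "sl_flux q \<mu> \<beta> u" B v C] \<mu>0 \<mu>1 B C by simp
  qed
  obtain s where s: "(\<lambda>k. q ^ k *\<^sub>R (\<Lambda> * sl_rhs q \<mu> \<beta> y (q ^ k) * z (q ^ k))) sums s"
      "(\<lambda>k. q ^ k *\<^sub>R (sl_flux q \<mu> \<beta> y (q ^ k) * caputo q \<mu> z (q ^ k))) sums s"
    using parts [OF y z] by blast
  obtain s' where s': "(\<lambda>k. q ^ k *\<^sub>R (\<Lambda>' * sl_rhs q \<mu> \<beta> z (q ^ k) * y (q ^ k))) sums s'"
      "(\<lambda>k. q ^ k *\<^sub>R (sl_flux q \<mu> \<beta> z (q ^ k) * caputo q \<mu> y (q ^ k))) sums s'"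
    using parts [OF z y] by blast
  have "(\<lambda>k. q ^ k *\<^sub>R (sl_flux q \<mu> \<beta> z (q ^ k) * caputo q \<mu> y (q ^ k)))
      = (\<lambda>k. q ^ k *\<^sub>R (sl_flux q \<mu> \<beta> y (q ^ k) * caputo q \<mu> z (q ^ k)))"
    by (simp add: sl_flux_def mult.commute)
  then have "s = s'"
    using s(2) s'(2) by (metis sums_unique2)
  then have "(\<lambda>k. q ^ k *\<^sub>R (\<Lambda> * sl_rhs q \<mu> \<beta> y (q ^ k) * z (q ^ k))
      - q ^ k *\<^sub>R (\<Lambda>' * sl_rhs q \<mu> \<beta> z (q ^ k) * y (q ^ k))) sums 0"
    using sums_diff [OF s(1) s'(1)] by simp
  then have "(\<lambda>k. inverse (\<Lambda> - \<Lambda>') * (q ^ k *\<^sub>R (\<Lambda> * sl_rhs q \<mu> \<beta> y (q ^ k) * z (q ^ k))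
      - q ^ k *\<^sub>R (\<Lambda>' * sl_rhs q \<mu> \<beta> z (q ^ k) * y (q ^ k)))) sums (inverse (\<Lambda> - \<Lambda>') * 0)"
    by (rule sums_mult)
  moreover have "inverse (\<Lambda> - \<Lambda>') * (q ^ k *\<^sub>R (\<Lambda> * sl_rhs q \<mu> \<beta> y (q ^ k) * z (q ^ k))
      - q ^ k *\<^sub>R (\<Lambda>' * sl_rhs q \<mu> \<beta> z (q ^ k) * y (q ^ k)))
      = q ^ k *\<^sub>R (sl_rhs q \<mu> \<beta> y (q ^ k) * z (q ^ k))" for k
  proof -
    define t where "t = q ^ k *\<^sub>R (sl_rhs q \<mu> \<beta> y (q ^ k) * z (q ^ k))"
    have "q ^ k *\<^sub>R (\<Lambda> * sl_rhs q \<mu> \<beta> y (q ^ k) * z (q ^ k))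
        - q ^ k *\<^sub>R (\<Lambda>' * sl_rhs q \<mu> \<beta> z (q ^ k) * y (q ^ k)) = (\<Lambda> - \<Lambda>') * t"
    proof -
      have "sl_rhs q \<mu> \<beta> z (q ^ k) * y (q ^ k) = sl_rhs q \<mu> \<beta> y (q ^ k) * z (q ^ k)"
        unfolding sl_rhs_lattice by simp
      then show ?thesis unfolding t_def by (simp add: mult.assoc left_diff_distrib scaleR_right_diff_distrib)
    qed
    then show ?thesis using ne by (simp add: t_def del: scaleR_left_diff_distrib)
  qed
  ultimately show ?thesis by (simp only: mult_zero_right)
qed

text \<open>The ratio of consecutive eigenvalues is \<open>q\<^sup>-\<^sup>\<mu> > 1\<close> times two quotients, each of which exceeds \<open>1\<close>
  because \<open>q\<^sup>\<mu> < 1\<close>.\<close>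

lemma sl_eigenvalue_strict_mono: "strict_mono (sl_eigenvalue q \<mu> \<beta>)"
proof (rule strict_monoI_Suc)
  fix n
  let ?P = "q powr \<mu> * q" and ?R = "q powr (\<beta> + 1)"
  define f where "f x = 1 - x * q ^ n" for x
  have f_pos: "x < 1 \<Longrightarrow> f x > 0" for x unfolding f_def by (rule qpoch_factor_pos)
  have f_mono: "x < y \<Longrightarrow> f y < f x" for x y unfolding f_def using q0 by simp
  have m: "q powr \<mu> < 1" using \<mu>0 by (rule q_powr_less_1)
  have P: "?P < q" using m q0 by simp
  have abq: "abq < ?R" using m q0 by (simp add: abq_eq)
  note lt = params_less_1(1-3)
  define X where "X = q_Gamma q (\<mu> + 1) * q_Gamma q (\<beta> + \<mu> + 1) / q_Gamma q (\<beta> + 1)"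
  have X: "X > 0" unfolding X_def using \<mu>0 \<beta> by (simp add: q_Gamma_pos)
  have Suc: "sl_eigenvalue q \<mu> \<beta> (Suc n)
      = sl_eigenvalue q \<mu> \<beta> n * (q powr - \<mu> * ((f abq * f ?P) / (f ?R * f q)))"
    unfolding sl_eigenvalue_eq f_def qpoch_nat_Suc by (simp add: ac_simps)
  have pos: "sl_eigenvalue q \<mu> \<beta> n > 0"
    unfolding sl_eigenvalue_eq X_def [symmetric] using X lt q0 q1 by (simp add: qpoch_nat_pos)
  have "f ?R * f q < f abq * f ?P"
    using f_mono [OF abq] f_mono [OF P] f_pos [OF lt(2)] f_pos [OF q1] by (intro mult_strict_mono) auto
  then have "1 < (f abq * f ?P) / (f ?R * f q)" using f_pos [OF lt(2)] f_pos [OF q1] by simp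
  moreover have "1 < q powr - \<mu>" using m q0 by (simp add: powr_minus one_less_inverse)
  ultimately have "1 * 1 < q powr - \<mu> * ((f abq * f ?P) / (f ?R * f q))"
    by (intro mult_strict_mono) auto
  then show "sl_eigenvalue q \<mu> \<beta> n < sl_eigenvalue q \<mu> \<beta> (Suc n)"
    unfolding Suc using mult_strict_left_mono [OF _ pos] by fastforce
qed

text \<open>The polynomial of index \<open>n\<close> has degree exactly \<open>n\<close>, so the monomial moments vanish one after the other.\<close>

lemma vanishing_jacobi_moments:
  fixes W :: "nat \<Rightarrow> complex"
  assumes W: "\<And>k. norm (W k) \<le> C" and ortho: "\<And>n. (\<lambda>k. q ^ k *\<^sub>R (W k * of_real (little_q_jacobi q \<mu> \<beta> n (q ^ k)))) sums 0"
  shows "W k = 0"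
proof (rule vanishing_moments [OF W])
  let ?c = "\<lambda>n. jacobi_coeff (q powr \<mu> * q) abq n"
  show "(\<lambda>k. W k * of_real ((q ^ k) ^ Suc j)) sums 0" for j
  proof (induction j rule: less_induct)
    case (less n)
    have "(\<lambda>k. inverse (?c n n) *\<^sub>R (q ^ k *\<^sub>R (W k * of_real (little_q_jacobi q \<mu> \<beta> n (q ^ k)))
        - (\<Sum>j<n. ?c n j *\<^sub>R (W k * of_real ((q ^ k) ^ Suc j)))))
        sums (inverse (?c n n) *\<^sub>R (0 - (\<Sum>j<n. ?c n j *\<^sub>R 0)))"
      by (intro sums_scaleR_right sums_diff sums_sum ortho less) simp
    moreover have "inverse (?c n n) *\<^sub>R (q ^ k *\<^sub>R (W k * of_real (little_q_jacobi q \<mu> \<beta> n (q ^ k)))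
        - (\<Sum>j<n. ?c n j *\<^sub>R (W k * of_real ((q ^ k) ^ Suc j)))) = W k * of_real ((q ^ k) ^ Suc n)" for k
    proof -
      have "q ^ k *\<^sub>R (W k * of_real (little_q_jacobi q \<mu> \<beta> n (q ^ k)))
          = (\<Sum>j\<le>n. ?c n j *\<^sub>R (W k * of_real ((q ^ k) ^ Suc j)))"
        unfolding little_q_jacobi_eq by (simp add: scaleR_conv_of_real sum_distrib_left ac_simps)
      then have "q ^ k *\<^sub>R (W k * of_real (little_q_jacobi q \<mu> \<beta> n (q ^ k)))
        - (\<Sum>j<n. ?c n j *\<^sub>R (W k * of_real ((q ^ k) ^ Suc j))) = ?c n n *\<^sub>R (W k * of_real ((q ^ k) ^ Suc n))"
        by (simp add: lessThan_Suc_atMost [symmetric])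
      then show ?thesis
        using jacobi_coeff_top_nonzero [OF params_less_1(1,4), of n] by simp
    qed
    ultimately show ?case by simp
  qed
qed

theorem sl_eigenfunction_unique:
  assumes y: "sl_eigenfunction q \<mu> \<beta> \<Lambda> y" and z: "sl_eigenfunction q \<mu> \<beta> \<Lambda> z"
  shows "\<exists>c. \<forall>x \<in> q_lattice q. z x = c * y x"
proof -
  let ?p = "little_q_jacobi q \<mu> \<beta>"
  let ?w = "\<lambda>k. qpoch (q * q ^ k) q \<beta>"
  define W where "W u k = ?w k *\<^sub>R u (q ^ k)" for u :: "real \<Rightarrow> complex" and k
  have sol: "sl_solution q \<mu> \<beta> \<Lambda> y" "sl_solution q \<mu> \<beta> \<Lambda> z"
    using y z by (simp_all add: sl_eigenfunction_def)
  obtain A where A: "\<And>k. \<bar>?w k\<bar> \<le> A" using qpoch_lattice_bounded [OF \<beta>] by blast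
  have bounded: "\<exists>C. \<forall>k. norm (W u k) \<le> C" if u: "sl_solution q \<mu> \<beta> \<Lambda> u" for u
  proof -
    obtain C where C: "\<And>n. norm (u (q ^ n)) \<le> C * (q powr \<mu>) ^ n"
      using sl_solution_bounds(1) [OF u] by blast
    have C0: "C \<ge> 0" using order_trans [OF norm_ge_zero C [of 0]] by simp
    have "norm (u (q ^ k)) \<le> C" for k
    proof -
      have "(q powr \<mu>) ^ k \<le> 1" using q_powr_less_1 [OF \<mu>0] by (simp add: power_le_one)
      then show ?thesis using order_trans [OF C [of k]] C0 by (simp add: mult_left_le)
    qed
    then have "norm (W u k) \<le> A * C" for k
      unfolding W_def norm_scaleR using order_trans [OF abs_ge_zero A [of 0]] by (intro mult_mono A) auto
    then show ?thesis by blast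
  qed
  have rhs: "sl_rhs q \<mu> \<beta> u (q ^ k) * sl_phi q \<mu> \<beta> n (q ^ k) = W u k * of_real (?p n (q ^ k))" for u n k
  proof -
    have "(q powr - \<mu>) ^ k * (q powr \<mu>) ^ k = 1"
      using q0 by (simp flip: power_mult_distrib powr_add)
    then have "complex_of_real ((q powr - \<mu>) ^ k) * complex_of_real ((q powr \<mu>) ^ k) = 1"
      by (simp flip: of_real_mult of_real_power)
    moreover have "sl_rhs q \<mu> \<beta> u (q ^ k) * sl_phi q \<mu> \<beta> n (q ^ k)
        = complex_of_real ((q powr - \<mu>) ^ k) * complex_of_real ((q powr \<mu>) ^ k) * (W u k * of_real (?p n (q ^ k)))"
      unfolding W_def sl_rhs_lattice sl_phi_lattice scaleR_conv_of_real of_real_mult by (simp only: ac_simps)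
    ultimately show ?thesis by simp
  qed
  \<comment> \<open>If \<open>\<Lambda>\<close> is none of the \<open>\<lambda>\<^sub>n\<close>, the choice of \<open>N\<close> is arbitrary and only means that \<open>\<phi>\<^sub>N\<close> is treated separately.\<close>
  define N where "N = (SOME N. \<Lambda> = of_real (sl_eigenvalue q \<mu> \<beta> N))"
  have other: "\<Lambda> \<noteq> of_real (sl_eigenvalue q \<mu> \<beta> n)" if "n \<noteq> N" for n
  proof
    assume L: "\<Lambda> = of_real (sl_eigenvalue q \<mu> \<beta> n)"
    then have "\<Lambda> = of_real (sl_eigenvalue q \<mu> \<beta> N)" unfolding N_def by (rule someI)
    with L that show False
      using strict_mono_imp_inj_on [OF sl_eigenvalue_strict_mono] by (auto dest: injD)
  qed
  have ortho: "(\<lambda>k. q ^ k *\<^sub>R (W u k * of_real (?p n (q ^ k)))) sums 0"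
    if "sl_solution q \<mu> \<beta> \<Lambda> u" "n \<noteq> N" for u n
    using sl_solutions_orthogonal [OF that(1) sl_phi_solution other [OF that(2)]] by (simp add: rhs)
  have summable: "summable (\<lambda>k. q ^ k *\<^sub>R (W u k * of_real (?p N (q ^ k))))" if u: "sl_solution q \<mu> \<beta> \<Lambda> u" for u
  proof -
    obtain C where C: "\<And>k. norm (W u k) \<le> C" using bounded [OF u] by blast
    let ?D = "\<Sum>j\<le>N. \<bar>jacobi_coeff (q powr \<mu> * q) abq N j\<bar>"
    have D: "\<bar>?p N (q ^ k)\<bar> \<le> ?D" for k
      unfolding little_q_jacobi_eq
    proof (rule order_trans [OF sum_abs], rule sum_mono)
      fix j
      have "\<bar>(q ^ k) ^ j\<bar> \<le> 1" using q0 q1 by (simp add: power_le_one flip: power_mult)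
      then show "\<bar>jacobi_coeff (q powr \<mu> * q) abq N j * (q ^ k) ^ j\<bar> \<le> \<bar>jacobi_coeff (q powr \<mu> * q) abq N j\<bar>"
        unfolding abs_mult by (rule mult_left_le) simp
    qed
    show ?thesis
    proof (rule summable_comparison_test')
      show "summable (\<lambda>k. q ^ k * (C * ?D))" using q0 q1 by (intro summable_mult2 summable_geometric) simp
      have "norm (W u k * of_real (?p N (q ^ k))) \<le> C * ?D" for k
        unfolding norm_mult norm_of_real using order_trans [OF norm_ge_zero C [of 0]] by (intro mult_mono C D) auto
      then show "norm (q ^ k *\<^sub>R (W u k * of_real (?p N (q ^ k)))) \<le> q ^ k * (C * ?D)" for k
        using q0 by (simp add: mult_left_mono)
    qed
  qed
  \<comment> \<open>The pairing with the one exceptional \<open>\<phi>\<^sub>N\<close>; it is a linear coordinate on the solutions.\<close>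
  define S where "S u = (\<Sum>k. q ^ k *\<^sub>R (W u k * of_real (?p N (q ^ k))))" for u
  have S: "(\<lambda>k. q ^ k *\<^sub>R (W u k * of_real (?p N (q ^ k)))) sums S u" if "sl_solution q \<mu> \<beta> \<Lambda> u" for u
    unfolding S_def by (rule summable_sums [OF summable [OF that]])
  have proportional: "v (q ^ k) = c * u (q ^ k)"
    if sol: "sl_solution q \<mu> \<beta> \<Lambda> u" "sl_solution q \<mu> \<beta> \<Lambda> v" and c: "S v = c * S u" for u v c k
  proof -
    obtain C1 C2 where C: "\<And>k. norm (W u k) \<le> C1" "\<And>k. norm (W v k) \<le> C2"
      using bounded sol by meson
    have "W v k - c * W u k = 0"
    proof (rule vanishing_jacobi_moments)
      show "norm (W v k - c * W u k) \<le> C2 + norm c * C1" for k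
        by (rule order_trans [OF norm_triangle_ineq4])
          (simp add: add_mono C norm_mult mult_left_mono)
      fix n
      have "(\<lambda>k. q ^ k *\<^sub>R (W v k * of_real (?p n (q ^ k))) - c * (q ^ k *\<^sub>R (W u k * of_real (?p n (q ^ k))))) sums 0"
      proof (cases "n = N")
        case True
        then show ?thesis using sums_diff [OF S [OF sol(2)] sums_mult [OF S [OF sol(1)], of c]] c by simp
      next
        case False
        show ?thesis
          using sums_diff [OF ortho [OF sol(2) False] sums_mult [OF ortho [OF sol(1) False], of c]] by simp
      qed
      then show "(\<lambda>k. q ^ k *\<^sub>R ((W v k - c * W u k) * of_real (?p n (q ^ k)))) sums 0"
        by (simp add: scaleR_conv_of_real algebra_simps)
    qed
    then have "?w k *\<^sub>R (v (q ^ k) - c * u (q ^ k)) = 0"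
      by (simp add: W_def scaleR_conv_of_real algebra_simps)
    then show ?thesis using qpoch_lattice_pos [OF \<beta>, of k] by simp
  qed
  have "S y \<noteq> 0"
  proof
    assume "S y = 0"
    \<comment> \<open>\<open>y\<close> is then the multiple \<open>0\<close> of itself.\<close>
    then have "y (q ^ k) = 0" for k using proportional [OF sol(1) sol(1), of 0] by simp
    moreover have "y 0 = 0" using sol(1) by (simp add: sl_solution_def)
    ultimately show False
      using y unfolding sl_eigenfunction_def q_lattice_def by auto
  qed
  then have "S z = S z / S y * S y" by simp
  then have "z (q ^ k) = S z / S y * y (q ^ k)" for k by (rule proportional [OF sol])
  moreover have "y 0 = 0" "z 0 = 0" using sol by (simp_all add: sl_solution_def)
  ultimately show ?thesis
    unfolding q_lattice_def by (intro exI [of _ "S z / S y"]) auto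
qed

end

section \<open>The Sturm--Liouville problem\<close>

theorem theorem5p5:
  fixes q \<mu> \<beta> :: real
  assumes "0 < q" and "q < 1" and "0 < \<mu>" and "\<mu> < 1" and "- 1 < \<beta>"
  shows "(\<forall>n. sl_eigenfunction q \<mu> \<beta> (of_real (sl_eigenvalue q \<mu> \<beta> n)) (sl_phi q \<mu> \<beta> n)) \<and>
    (\<forall>\<Lambda> y z. sl_eigenfunction q \<mu> \<beta> \<Lambda> y \<and> sl_eigenfunction q \<mu> \<beta> \<Lambda> z \<longrightarrow>
      (\<exists>c. \<forall>x \<in> q_lattice q. z x = c * y x))"
proof -
  interpret sl_problem q \<mu> \<beta>
    using assms by unfold_locales
  have "sl_eigenfunction q \<mu> \<beta> (of_real (sl_eigenvalue q \<mu> \<beta> n)) (sl_phi q \<mu> \<beta> n)" for n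
    by (rule sl_phi_eigenfunction)
  then show ?thesis
    using sl_eigenfunction_unique by blast
qed

end
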